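(* Let $0<p<\tilde p\le 1/2$ and let $1=t_0<t_1<\dots<t_n<\cdots$ be integers with $\lim_{n\to\infty} t_n/t_{n+1}=0$. Let $\mathbb X=\{0,1\}^{\mathbb N^*}$ (with $\mathbb N^*=\{1,2,\dots\}$) be endowed with the ultrametric which assigns diameter $2^{-n}$ to cylinders of order $n$, and let $\mu$ be the probability measure on $\mathbb X$ which assigns to each cylinder the mass $\mu([\varepsilon_1\varepsilon_2\dots\varepsilon_n])=\prod_{j=1}^n\varpi_j$, where - if $t_{2k-1}\le j<t_{2k}$ for some $k$, then $\varpi_j=p$ if $\varepsilon_j=0$ and $\varpi_j=1-p$ otherwise; - if $t_{2k}\le j<t_{2k+1}$ for some $k$, then $\varpi_j=\tilde p$ if $\varepsilon_j=0$ and $\varpi_j=1-\tilde p$ otherwise. Let $b(q)=b_{\mu,\mathrm S_\mu}(q)$ and $B(q)=B_{\mu,\mathrm S_\mu}(q)$, $q\in\mathbb R$, be the Hausdorff and packing multifractal functions of $\mu$ (defined in the context; here $\mathrm S_\mu=\mathbb X$), let $B'_l,B'_r$ be the left and right derivatives of the convex function $B$, and let $$X_\mu(\alpha)=\Bigl\{x\in\mathbb X\ ;\ \lim_{r\searrow0}\frac{\log\mu(\mathsf B(x,r))}{\log r}=\alpha\Bigr\}.$$ Then: 1. For every $\alpha\in\bigl(-\log_2(1-\tilde p),-\log_2\tilde p\bigr)$, $$\dim_H X_\mu(\alpha)=\inf_{q\in\mathbb R}\bigl(b(q)+\alpha q\bigr).$$ 2. For every $\alpha\in\bigl(-\log_2(1-\tilde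 p),-\log_2\tilde p\bigr)\setminus\bigl([-B'_r(0),-B'_l(0)]\cup[-B'_r(1),-B'_l(1)]\bigr)$, $$\dim_P X_\mu(\alpha)=\inf_{q\in\mathbb R}\bigl(B(q)+\alpha q\bigr).$$
   Context: $\dim_H$ and $\dim_P$ are the Hausdorff and (Tricot) packing dimensions. $\mathsf B(x,r)$ is the open ball; in a collection of balls $\{\mathsf B_j\}$, $\mathsf B_j=\mathsf B(x_j,r_j)$. A $\delta$-packing of $E$ is a collection of pairwise disjoint balls centered in $E$ with radii $\le\delta$; a centered $\delta$-cover of $E$ is a collection of balls with centers in $E$ and radii $\le\delta$ whose union contains $E$. The support $\mathrm S_\mu$ is the complement of the union of all balls of $\mu$-measure $0$. For $q,t\in\mathbb R$, $\delta>0$ and $E\subset\mathbb X$ (where $\sum^*$ means summing only the terms with $\mu(\mathsf B_j)\ne0$): $$\overline{\mathscr P}^{q,t}_{\mu,\delta}(E)=\sup\Bigl\{\sum\nolimits^{*} r_j^t\mu(\mathsf B_j)^q;\ \{\mathsf B_j\}\ \delta\text{-packing of }E\Bigr\},\quad \overline{\mathscr P}^{q,t}_{\mu}(E)=\lim_{\delta\searrow0}\overline{\mathscr P}^{q,t}_{\mu,\delta}(E),$$ $$\mathscr P^{q,t}_\mu(E)=\inf\Bigl\{\sum_j\overline{\mathscr P}^{q,t}_\mu(E_j);\ E\subset\bigcup_j E_j\Bigr\}\ \text{(countable covers)},$$ $$\overline{\mathscr H}^{q,t}_{\mu,\delta}(E)=\inf\Bigl\{\sum\nolimits^{*} r_j^t\mu(\mathsf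 B_j)^q;\ \{\mathsf B_j\}\ \text{centered }\delta\text{-cover of }E\Bigr\},\quad \overline{\mathscr H}^{q,t}_{\mu}(E)=\lim_{\delta\searrow0}\overline{\mathscr H}^{q,t}_{\mu,\delta}(E),$$ $$\mathscr H^{q,t}_\mu(E)=\sup\{\overline{\mathscr H}^{q,t}_\mu(F);\ F\subset E\}.$$ Then $B_{\mu,E}(q)=\inf\{t\in\mathbb R;\ \mathscr P^{q,t}_\mu(E)=0\}$ and $b_{\mu,E}(q)=\inf\{t\in\mathbb R;\ \mathscr H^{q,t}_\mu(E)=0\}$. *)

theory Defs
  imports "HOL-Probability.Probability"
begin

section \<open>The sequence space\<close>

typedef cantor = "{1::nat..} \<rightarrow>\<^sub>E (UNIV :: bool set)"
  morphisms coord Abs_cantor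
  by (simp add: PiE_eq_empty_iff ex_in_conv)

lemma coord_eqI:
  assumes "\<And>j. j \<ge> 1 \<Longrightarrow> coord x j = coord y j"
  shows "x = y"
proof -
  have "coord x = coord y"
    by (rule PiE_ext[OF coord coord]) (use assms in auto)
  then show ?thesis by (simp add: coord_inject)
qed

text \<open>The distance of two distinct sequences is \<open>2\<^sup>-\<^sup>n\<close>, where \<open>n\<close> is the number of their
  common leading terms; \<open>diameter_cylinder\<close> below shows that this is the normalisation under
  which cylinders of order \<open>n\<close> have diameter \<open>2\<^sup>-\<^sup>n\<close>.\<close>

instantiation cantor :: metric_space
begin

definition dist_cantor :: "cantor \<Rightarrow> cantor \<Rightarrow> real" where
  "dist_cantor x y =
     (if x = y then 0 else (1/2) ^ (LEAST n. coord x (Suc n) \<noteq> coord y (Suc n)))"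

definition uniformity_cantor :: "(cantor \<times> cantor) filter" where
  "uniformity_cantor = (INF e\<in>{0 <..}. principal {(x, y). dist x y < e})"

definition open_cantor :: "cantor set \<Rightarrow> bool" where
  "open_cantor U = (\<forall>x\<in>U. eventually (\<lambda>(x', y). x' = x \<longrightarrow> y \<in> U) uniformity)"

lemma dist_cantor_le_iff:
  "dist x y \<le> (1/2) ^ n \<longleftrightarrow> (\<forall>j\<in>{1..n}. coord x j = coord y j)" for x y :: cantor
proof (cases "x = y")
  case True
  then show ?thesis by (simp add: dist_cantor_def)
next
  case False
  define k where "k = (LEAST n. coord x (Suc n) \<noteq> coord y (Suc n))"
  have "\<exists>m. coord x (Suc m) \<noteq> coord y (Suc m)"
    proof (rule ccontr)
    assume "\<nexists>m. coord x (Suc m) \<noteq> coord y (Suc m)"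
    then have "x = y"
      by (intro coord_eqI) (metis One_nat_def Suc_le_D)
    with False show False ..
  qed
  then have k: "coord x (Suc k) \<noteq> coord y (Suc k)"
    unfolding k_def by (rule LeastI_ex)
  have less: "coord x (Suc m) = coord y (Suc m)" if "m < k" for m
    using not_less_Least[of m "\<lambda>n. coord x (Suc n) \<noteq> coord y (Suc n)"] that
    unfolding k_def by blast
  have "dist x y \<le> (1/2) ^ n \<longleftrightarrow> n \<le> k"
    using False unfolding dist_cantor_def k_def[symmetric] by (simp add: power_decreasing_iff)
  also have "\<dots> \<longleftrightarrow> (\<forall>j\<in>{1..n}. coord x j = coord y j)"
  proof
    assume "n \<le> k"
    show "\<forall>j\<in>{1..n}. coord x j = coord y j"
    proof
      fix j assume j: "j \<in> {1..n}"
      then obtain m where "j = Suc m" by (cases j) auto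
      then show "coord x j = coord y j" using less[of m] j \<open>n \<le> k\<close> by auto
    qed
  next
    assume "\<forall>j\<in>{1..n}. coord x j = coord y j"
    then have "Suc k \<notin> {1..n}" using k by blast
    then show "n \<le> k" by simp
  qed
  finally show ?thesis .
qed

lemma dist_cantor_ultrametric: "dist x y \<le> max (dist x z) (dist y z)" for x y z :: cantor
proof (cases "x = z \<or> y = z")
  case True
  moreover have "dist y x = dist x y"
    unfolding dist_cantor_def by (simp add: eq_commute)
  moreover have "dist x y \<ge> 0"
    by (simp add: dist_cantor_def)
  ultimately show ?thesis by auto
next
  case False
  then obtain m n where mn: "dist x z = (1/2) ^ m" "dist y z = (1/2) ^ n"
    by (auto simp: dist_cantor_def)
  have "dist x z \<le> (1/2) ^ min m n" "dist y z \<le> (1/2) ^ min m n"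
    unfolding mn by (simp_all add: power_decreasing)
  then have "dist x y \<le> (1/2) ^ min m n"
    unfolding dist_cantor_le_iff by auto
  also have "\<dots> = max (dist x z) (dist y z)"
    unfolding mn by (auto simp: min_def max_def power_decreasing_iff)
  finally show ?thesis .
qed

instance
proof
  fix x y z :: cantor
  show "dist x y = 0 \<longleftrightarrow> x = y"
    by (simp add: dist_cantor_def)
  have "dist x z \<ge> 0" "dist y z \<ge> 0"
    by (simp_all add: dist_cantor_def)
  then show "dist x y \<le> dist x z + dist y z"
    using dist_cantor_ultrametric[of x y z] by linarith
qed (simp_all add: uniformity_cantor_def open_cantor_def)

end

definition cylinder :: "(nat \<Rightarrow> bool) \<Rightarrow> nat \<Rightarrow> cantor set" where
  "cylinder \<epsilon> n = {x. \<forall>j\<in>{1..n}. coord x j = \<epsilon> j}"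

lemma diameter_cylinder: "diameter (cylinder \<epsilon> n) = (1/2) ^ n"
proof (rule antisym)
  define x where "x = Abs_cantor (restrict \<epsilon> {1..})"
  define y where "y = Abs_cantor (restrict (\<epsilon>(Suc n := \<not> \<epsilon> (Suc n))) {1..})"
  have x: "coord x = restrict \<epsilon> {1..}"
    unfolding x_def by (rule Abs_cantor_inverse) auto
  have y: "coord y = restrict (\<epsilon>(Suc n := \<not> \<epsilon> (Suc n))) {1..}"
    unfolding y_def by (rule Abs_cantor_inverse) auto
  have mem: "x \<in> cylinder \<epsilon> n" "y \<in> cylinder \<epsilon> n"
    by (auto simp: cylinder_def x y)
  have le: "dist u v \<le> (1/2) ^ n" if "u \<in> cylinder \<epsilon> n" "v \<in> cylinder \<epsilon> n" for u v
    using that unfolding dist_cantor_le_iff by (auto simp: cylinder_def)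
  have neq: "coord x (Suc n) \<noteq> coord y (Suc n)"
    by (simp add: x y)
  have "(LEAST m. coord x (Suc m) \<noteq> coord y (Suc m)) = n"
    by (rule Least_equality) (auto simp: x y split: if_splits)
  then have d: "dist x y = (1/2) ^ n"
    using neq by (auto simp: dist_cantor_def)
  show "diameter (cylinder \<epsilon> n) \<le> (1/2) ^ n"
    unfolding diameter_def using mem by (auto intro!: cSUP_least le)
  have "bounded (cylinder \<epsilon> n)"
    unfolding bounded_def using le mem by blast
  then show "(1/2) ^ n \<le> diameter (cylinder \<epsilon> n)"
    using diameter_bounded_bound[OF _ mem] d by simp
qed

section \<open>Packings and centered covers\<close>

text \<open>A collection of balls is a set of pairs (center, radius): in an ultrametric space a ball
  determines neither its center nor its radius.\<close>

definition delta_packing :: "real \<Rightarrow> 'a::metric_space set \<Rightarrow> ('a \<times> real) set \<Rightarrow> bool" where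
  "delta_packing \<delta> E \<B> \<longleftrightarrow>
     (\<forall>(x, r)\<in>\<B>. x \<in> E \<and> 0 < r \<and> r \<le> \<delta>) \<and> disjoint_family_on (\<lambda>(x, r). ball x r) \<B>"

definition centered_cover :: "real \<Rightarrow> 'a::metric_space set \<Rightarrow> ('a \<times> real) set \<Rightarrow> bool" where
  "centered_cover \<delta> E \<B> \<longleftrightarrow>
     (\<forall>(x, r)\<in>\<B>. x \<in> E \<and> 0 < r \<and> r \<le> \<delta>) \<and> E \<subseteq> (\<Union>(x, r)\<in>\<B>. ball x r)"

section \<open>Hausdorff and packing dimension\<close>

text \<open>\<open>diam(U)\<^sup>s\<close> with the usual conventions \<open>0\<^sup>0 = 1\<close> for nonempty \<open>U\<close>, and \<open>0\<close> for empty \<open>U\<close>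
  (whereas \<^term>\<open>0 powr 0 = (0::real)\<close>).\<close>

definition diam_pow :: "real \<Rightarrow> 'a::metric_space set \<Rightarrow> ennreal" where
  "diam_pow s U = (if U = {} then 0 else if s = 0 then 1 else ennreal (diameter U powr s))"

definition hausdorff_pre :: "real \<Rightarrow> real \<Rightarrow> 'a::metric_space set \<Rightarrow> ennreal" where
  "hausdorff_pre s \<delta> E =
     (INF U\<in>{U :: nat \<Rightarrow> 'a set. (\<forall>i. bounded (U i) \<and> diameter (U i) \<le> \<delta>) \<and> E \<subseteq> (\<Union>i. U i)}.
        \<Sum>i. diam_pow s (U i))"

definition hausdorff_measure :: "real \<Rightarrow> 'a::metric_space set \<Rightarrow> ennreal" where
  "hausdorff_measure s E = Lim (at_right 0) (\<lambda>\<delta>. hausdorff_pre s \<delta> E)"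

definition hausdorff_dim :: "'a::metric_space set \<Rightarrow> ereal" where
  "hausdorff_dim E = Inf (ereal ` {s. 0 \<le> s \<and> hausdorff_measure s E = 0})"

definition packing_pre_delta :: "real \<Rightarrow> real \<Rightarrow> 'a::metric_space set \<Rightarrow> ennreal" where
  "packing_pre_delta s \<delta> E =
     (SUP \<B>\<in>{\<B>. delta_packing \<delta> E \<B>}. \<Sum>\<^sub>\<infinity>(x, r)\<in>\<B>. ennreal (r powr s))"

definition packing_pre :: "real \<Rightarrow> 'a::metric_space set \<Rightarrow> ennreal" where
  "packing_pre s E = Lim (at_right 0) (\<lambda>\<delta>. packing_pre_delta s \<delta> E)"

definition packing_measure :: "real \<Rightarrow> 'a::metric_space set \<Rightarrow> ennreal" where
  "packing_measure s E =
     (INF F\<in>{F :: nat \<Rightarrow> 'a set. E \<subseteq> (\<Union>i. F i)}. \<Sum>i. packing_pre s (F i))"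

definition packing_dim :: "'a::metric_space set \<Rightarrow> ereal" where
  "packing_dim E = Inf (ereal ` {s. 0 \<le> s \<and> packing_measure s E = 0})"

section \<open>Multifractal measures and functions\<close>

definition msupport :: "'a::metric_space measure \<Rightarrow> 'a set" where
  "msupport \<mu> = - \<Union>{ball x r | x r. 0 < r \<and> emeasure \<mu> (ball x r) = 0}"

text \<open>The sum \<open>\<Sum>\<^sup>* r\<^sub>j\<^sup>t \<mu>(B\<^sub>j)\<^sup>q\<close> over the balls of nonzero measure;
  \<open>\<mu>\<close> is meant to be finite on balls.\<close>

definition mf_sum :: "'a::metric_space measure \<Rightarrow> real \<Rightarrow> real \<Rightarrow> ('a \<times> real) set \<Rightarrow> ennreal" where
  "mf_sum \<mu> q t \<B> =
     (\<Sum>\<^sub>\<infinity>(x, r)\<in>{(x, r)\<in>\<B>. measure \<mu> (ball x r) \<noteq> 0}.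
        ennreal (r powr t * measure \<mu> (ball x r) powr q))"

definition mf_packing_pre_delta ::
    "'a::metric_space measure \<Rightarrow> real \<Rightarrow> real \<Rightarrow> real \<Rightarrow> 'a set \<Rightarrow> ennreal" where
  "mf_packing_pre_delta \<mu> q t \<delta> E = (SUP \<B>\<in>{\<B>. delta_packing \<delta> E \<B>}. mf_sum \<mu> q t \<B>)"

definition mf_packing_pre ::
    "'a::metric_space measure \<Rightarrow> real \<Rightarrow> real \<Rightarrow> 'a set \<Rightarrow> ennreal" where
  "mf_packing_pre \<mu> q t E = Lim (at_right 0) (\<lambda>\<delta>. mf_packing_pre_delta \<mu> q t \<delta> E)"

definition mf_packing ::
    "'a::metric_space measure \<Rightarrow> real \<Rightarrow> real \<Rightarrow> 'a set \<Rightarrow> ennreal" where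
  "mf_packing \<mu> q t E =
     (INF F\<in>{F :: nat \<Rightarrow> 'a set. E \<subseteq> (\<Union>i. F i)}. \<Sum>i. mf_packing_pre \<mu> q t (F i))"

definition mf_hausdorff_pre_delta ::
    "'a::metric_space measure \<Rightarrow> real \<Rightarrow> real \<Rightarrow> real \<Rightarrow> 'a set \<Rightarrow> ennreal" where
  "mf_hausdorff_pre_delta \<mu> q t \<delta> E = (INF \<B>\<in>{\<B>. centered_cover \<delta> E \<B>}. mf_sum \<mu> q t \<B>)"

definition mf_hausdorff_pre ::
    "'a::metric_space measure \<Rightarrow> real \<Rightarrow> real \<Rightarrow> 'a set \<Rightarrow> ennreal" where
  "mf_hausdorff_pre \<mu> q t E = Lim (at_right 0) (\<lambda>\<delta>. mf_hausdorff_pre_delta \<mu> q t \<delta> E)"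

definition mf_hausdorff ::
    "'a::metric_space measure \<Rightarrow> real \<Rightarrow> real \<Rightarrow> 'a set \<Rightarrow> ennreal" where
  "mf_hausdorff \<mu> q t E = (SUP F\<in>{F. F \<subseteq> E}. mf_hausdorff_pre \<mu> q t F)"

definition mf_B :: "'a::metric_space measure \<Rightarrow> 'a set \<Rightarrow> real \<Rightarrow> ereal" where
  "mf_B \<mu> E q = Inf (ereal ` {t. mf_packing \<mu> q t E = 0})"

definition mf_b :: "'a::metric_space measure \<Rightarrow> 'a set \<Rightarrow> real \<Rightarrow> ereal" where
  "mf_b \<mu> E q = Inf (ereal ` {t. mf_hausdorff \<mu> q t E = 0})"

definition level_set :: "'a::metric_space measure \<Rightarrow> real \<Rightarrow> 'a set" where
  "level_set \<mu> \<alpha> = {x. ((\<lambda>r. ln (measure \<mu> (ball x r)) / ln r) \<longlongrightarrow> \<alpha>) (at_right 0)}"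

definition left_deriv :: "(real \<Rightarrow> real) \<Rightarrow> real \<Rightarrow> real" where
  "left_deriv f x = Lim (at_left x) (\<lambda>y. (f y - f x) / (y - x))"

definition right_deriv :: "(real \<Rightarrow> real) \<Rightarrow> real \<Rightarrow> real" where
  "right_deriv f x = Lim (at_right x) (\<lambda>y. (f y - f x) / (y - x))"

end

theory Submission
  imports Defs "HOL-Real_Asymp.Real_Asymp"
begin

text \<open>
  Write \<open>\<theta>\<^sub>u\<close> for the pressure \<open>q \<mapsto> log\<^sub>2(u\<^sup>q + (1 - u)\<^sup>q)\<close>. On blocks ruled by \<open>u \<in> {p, pt}\<close> give the
  symbol \<open>\<epsilon>\<close> the Gibbs weight \<open>\<varpi>(\<epsilon>)\<^sup>q 2\<^sup>-\<^sup>\<theta>\<close>, with \<open>q = q\<^sub>u\<close> chosen such that the mean of \<open>- log\<^sub>2 \<varpi>\<close> is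
  \<open>\<alpha>\<close>. By the strong law the resulting product measure lives on the level set, and its local entropy is
  the running average of \<open>h\<^sub>u = \<theta>\<^sub>u(q\<^sub>u) + \<alpha> q\<^sub>u\<close>. These averages stay above the smaller of the two
  \<open>h\<^sub>u\<close> and, as each block dwarfs its predecessors, return arbitrarily close to the larger, so the mass
  distribution principle bounds the Hausdorff dimension below by the smaller, and a density theorem bounds
  the packing dimension below by the larger.

  Conversely, Hausdorff and packing dimension of the level set are at most \<open>b(q) + \<alpha> q\<close> and
  \<open>B(q) + \<alpha> q\<close> for every \<open>q\<close>. Covering by cylinders gives \<open>b \<le> min(\<theta>\<^sub>p, \<theta>\<^sub>p\<^sub>t)\<close>, which settles the first
  claim at the \<open>q\<^sub>u\<close> of smaller entropy. Moreover \<open>B = max(\<theta>\<^sub>p, \<theta>\<^sub>p\<^sub>t)\<close>, which is \<open>\<theta>\<^sub>p\<^sub>t\<close> on \<open>[0, 1]\<close> and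
  \<open>\<theta>\<^sub>p\<close> elsewhere; so the upper bound is attained at some \<open>q\<^sub>u\<close> unless \<open>q\<^sub>p \<in> (0, 1)\<close> and
  \<open>q\<^sub>p\<^sub>t \<notin> [0, 1]\<close>, and in that case \<open>- \<alpha>\<close> lies between the one-sided derivatives of \<open>B\<close> at \<open>0\<close> or
  at \<open>1\<close>.
\<close>

section \<open>Sums, limits and infima\<close>

lemma ennreal_summable_on [simp]: "f summable_on A" for f :: "'a \<Rightarrow> ennreal"
  by (rule nonneg_summable_on_complete) simp

lemma sum_le_infsum_ennreal:
  fixes f :: "'a \<Rightarrow> ennreal"
  assumes "finite F" "F \<subseteq> A"
  shows "sum f F \<le> infsum f A"
  using assms by (subst nonneg_infsum_complete) (auto intro: SUP_upper)

lemma infsum_cmult_le_ennreal: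
  fixes f :: "'a \<Rightarrow> ennreal"
  shows "(\<Sum>\<^sub>\<infinity>x\<in>A. c * f x) \<le> c * infsum f A"
proof (rule infsum_le_finite_sums)
  fix F assume "finite F" "F \<subseteq> A"
  then show "(\<Sum>x\<in>F. c * f x) \<le> c * infsum f A"
    unfolding sum_distrib_left[symmetric] by (intro mult_left_mono sum_le_infsum_ennreal) auto
qed simp

lemma infsum_mono_ennreal:
  fixes f g :: "'a \<Rightarrow> ennreal"
  assumes "\<And>x. x \<in> A \<Longrightarrow> f x \<le> g x"
  shows "infsum f A \<le> infsum g A"
  by (rule infsum_mono) (use assms in auto)

lemma countable_of_infsum_ennreal:
  fixes f :: "'a \<Rightarrow> ennreal"
  assumes not_top: "infsum f A \<noteq> \<top>" and nonzero: "\<And>x. x \<in> A \<Longrightarrow> f x \<noteq> 0"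
  shows "countable A"
proof -
  define B where "B n = {x\<in>A. ennreal (inverse (real (Suc n))) \<le> f x}" for n :: nat
  have "finite (B n)" for n
  proof (rule ccontr)
    assume "infinite (B n)"
    then have "infsum f (B n) = \<top>"
      by (intro infsum_superconst_infinite_ennreal[where b = "ennreal (inverse (real (Suc n)))",
            unfolded infinity_ennreal_def]) (auto simp: B_def)
    moreover have "infsum f (B n) \<le> infsum f A"
      by (rule infsum_mono_neutral) (auto simp: B_def)
    ultimately show False using not_top by (simp add: top_unique)
  qed
  moreover have "A = (\<Union>n. B n)"
  proof -
    have "\<exists>n. x \<in> B n" if "x \<in> A" for x
    proof -
      have "f x \<noteq> 0" by (rule nonzero[OF that])
      then have "0 < enn2real (min 1 (f x))" "ennreal (enn2real (min 1 (f x))) \<le> f x"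
        by (auto simp: enn2real_positive_iff min_less_iff_disj zero_less_iff_neq_zero)
      then obtain e where "0 < e" and e_le: "ennreal e \<le> f x" by blast
      obtain n where "inverse (real (Suc n)) < e" using reals_Archimedean[OF \<open>0 < e\<close>] by blast
      then have "ennreal (inverse (real (Suc n))) \<le> f x"
        by (intro order.trans[OF ennreal_leI e_le]) simp
      then show ?thesis using that by (auto simp: B_def)
    qed
    then show ?thesis by (auto simp: B_def)
  qed
  ultimately show ?thesis by (metis countable_UN countableI_type countable_finite)
qed

lemma suminf_from_nat_into_le_infsum:
  fixes f :: "'i \<Rightarrow> ennreal"
  assumes countable: "countable I"
  shows "(\<Sum>n. if n \<in> to_nat_on I ` I then f (from_nat_into I n) else 0) \<le> infsum f I"
proof (rule suminf_le_const)
  fix N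
  define J where "J = {..<N} \<inter> to_nat_on I ` I"
  have inj: "inj_on (from_nat_into I) J" using countable by (auto simp: J_def inj_on_def)
  have "(\<Sum>n<N. if n \<in> to_nat_on I ` I then f (from_nat_into I n) else 0)
      = (\<Sum>n\<in>J. f (from_nat_into I n))"
    by (simp add: J_def sum.inter_restrict)
  also have "\<dots> = sum f (from_nat_into I ` J)" by (simp add: sum.reindex[OF inj])
  also have "\<dots> \<le> infsum f I"
    using countable by (intro sum_le_infsum_ennreal) (auto simp: J_def)
  finally show "(\<Sum>n<N. if n \<in> to_nat_on I ` I then f (from_nat_into I n) else 0) \<le> infsum f I" .
qed simp

lemma suminf_ennreal_power_half: "0 \<le> c \<Longrightarrow> (\<Sum>i. ennreal (c * (1/2) ^ Suc i)) = ennreal c"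
  using sums_mult[OF power_half_series, of c]
  by (subst suminf_ennreal2) (auto simp: sums_iff)

lemma sum_power_atLeastAtMost_le:
  fixes \<rho> :: real
  assumes "0 \<le> \<rho>" "\<rho> < 1"
  shows "(\<Sum>n=M..L. \<rho> ^ n) \<le> \<rho> ^ M / (1 - \<rho>)"
proof (cases "M \<le> L")
  case True
  then have "(\<Sum>n=M..L. \<rho> ^ n) = (\<rho> ^ M - \<rho> ^ Suc L) / (1 - \<rho>)"
    using assms by (subst sum_gp) auto
  also have "\<dots> \<le> \<rho> ^ M / (1 - \<rho>)" using assms by (intro divide_right_mono) auto
  finally show ?thesis .
qed (use assms in auto)

lemma le_cmult_INF_ennreal:
  fixes f :: "'a \<Rightarrow> ennreal"
  assumes c_pos: "0 < c" and z_le: "\<And>x. x \<in> A \<Longrightarrow> z \<le> ennreal c * f x"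
  shows "z \<le> ennreal c * (INF x\<in>A. f x)"
proof -
  have c_inverse: "ennreal c * ennreal (1 / c) = 1" using c_pos by (simp flip: ennreal_mult)
  have "ennreal (1 / c) * z \<le> (INF x\<in>A. f x)"
  proof (rule INF_greatest)
    fix x assume "x \<in> A"
    then have "ennreal (1 / c) * z \<le> ennreal (1 / c) * (ennreal c * f x)"
      by (intro mult_left_mono z_le) auto
    also have "\<dots> = f x" using c_inverse by (simp add: mult.assoc[symmetric] mult.commute)
    finally show "ennreal (1 / c) * z \<le> f x" .
  qed
  then have "ennreal c * (ennreal (1 / c) * z) \<le> ennreal c * (INF x\<in>A. f x)"
    by (rule mult_left_mono) simp
  then show ?thesis by (simp add: mult.assoc[symmetric] c_inverse)
qed

lemma Lim_at_right_eq_INF: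
  fixes f :: "real \<Rightarrow> 'b::{complete_linorder, linorder_topology}"
  assumes "mono_on {x<..} f"
  shows "Lim (at_right x) f = (INF y\<in>{x<..}. f y)"
proof (rule tendsto_Lim)
  show "(f \<longlongrightarrow> (INF y\<in>{x<..}. f y)) (at_right x)"
    using Lim_right_bound[of UNIV x f bot] assms by (simp add: monotone_on_def)
qed simp

lemma Lim_at_right_eq_SUP:
  fixes f :: "real \<Rightarrow> 'b::{complete_linorder, linorder_topology}"
  assumes "antimono_on {x<..} f"
  shows "Lim (at_right x) f = (SUP y\<in>{x<..}. f y)"
proof (rule tendsto_Lim)
  show "(f \<longlongrightarrow> (SUP y\<in>{x<..}. f y)) (at_right x)"
  proof (rule order_tendstoI)
    fix a assume "a < (SUP y\<in>{x<..}. f y)"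
    then obtain d where "x < d" and a_less: "a < f d" by (auto simp: less_SUP_iff)
    show "\<forall>\<^sub>F y in at_right x. a < f y"
      using eventually_at_right_real[OF \<open>x < d\<close>]
    proof eventually_elim
      case (elim y)
      then have "f d \<le> f y" using assms by (auto simp: monotone_on_def)
      with a_less show ?case by (rule less_le_trans)
    qed
  next
    fix a assume SUP_less: "(SUP y\<in>{x<..}. f y) < a"
    show "\<forall>\<^sub>F y in at_right x. f y < a"
      using eventually_at_right_less[of x]
      by eventually_elim (rule le_less_trans[OF SUP_upper SUP_less], simp)
  qed
qed simp

lemma tendsto_lowerbound_frequently:
  fixes f :: "'a \<Rightarrow> 'b::linorder_topology"
  assumes "(f \<longlongrightarrow> l) F" "\<exists>\<^sub>F x in F. a \<le> f x"
  shows "a \<le> l"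
proof (rule ccontr)
  assume "\<not> a \<le> l"
  then have "\<forall>\<^sub>F x in F. f x < a" using order_tendstoD(2)[OF assms(1)] by simp
  then show False using assms(2) by (simp add: frequently_def not_le)
qed

lemma half_power_powr: "((1/2::real) ^ n) powr s = 2 powr (- (s * real n))"
proof -
  have "(1/2::real) ^ n = 2 powr (- real n)"
    by (simp add: powr_minus powr_realpow power_one_over inverse_eq_divide)
  then show ?thesis by (simp add: powr_powr mult.commute)
qed

lemma half_power_powr_mult: "((1/2::real) ^ n) powr t * 2 powr (a * real n) = (2 powr (a - t)) ^ n"
  unfolding half_power_powr
  by (simp add: powr_realpow[symmetric] powr_powr powr_add[symmetric] algebra_simps)

lemma Inf_ereal_Collect_le:
  assumes "\<And>t. a < t \<Longrightarrow> P t"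
  shows "Inf (ereal ` {t. P t}) \<le> ereal a"
proof (rule ereal_le_epsilon2)
  fix e :: real assume "0 < e"
  then have "ereal (a + e) \<in> ereal ` {t. P t}" using assms by simp
  then show "Inf (ereal ` {t. P t}) \<le> ereal a + ereal e" by (simp add: Inf_lower)
qed

lemma le_Inf_ereal_Collect:
  assumes "\<And>t. t < a \<Longrightarrow> \<not> P t"
  shows "ereal a \<le> Inf (ereal ` {t. P t})"
  using assms by (intro Inf_greatest) (force simp: not_less[symmetric])

lemma le_max_0_Inf_plus:
  assumes "\<And>t. P t \<Longrightarrow> d \<le> ereal (max 0 (t + c))"
  shows "d \<le> max 0 (Inf (ereal ` {t. P t}) + ereal c)"
proof (cases "d \<le> 0")
  case False
  have "d - ereal c \<le> Inf (ereal ` {t. P t})"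
  proof (rule Inf_greatest, safe)
    fix t assume "P t"
    then have "d \<le> ereal t + ereal c"
      using assms[of t] False by (auto simp: max_def zero_ereal_def split: if_splits)
    then show "d - ereal c \<le> ereal t" by (simp add: ereal_minus_le)
  qed
  then show ?thesis by (simp add: ereal_minus_le le_max_iff_disj)
qed (simp add: le_max_iff_disj)

section \<open>Outer measures from countable covers\<close>

definition cover_measure :: "('a set \<Rightarrow> bool) \<Rightarrow> ('a set \<Rightarrow> ennreal) \<Rightarrow> 'a set \<Rightarrow> ennreal" where
  "cover_measure P \<tau> E =
     (INF F\<in>{F :: nat \<Rightarrow> 'a set. (\<forall>i. P (F i)) \<and> E \<subseteq> (\<Union>i. F i)}. \<Sum>i. \<tau> (F i))"

lemma cover_measure_le:
  fixes F :: "nat \<Rightarrow> 'a set"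
  assumes "\<And>i. P (F i)" "E \<subseteq> (\<Union>i. F i)"
  shows "cover_measure P \<tau> E \<le> (\<Sum>i. \<tau> (F i))"
  unfolding cover_measure_def by (rule INF_lower) (use assms in auto)

lemma cover_measure_subset: "E \<subseteq> E' \<Longrightarrow> cover_measure P \<tau> E \<le> cover_measure P \<tau> E'"
  unfolding cover_measure_def by (rule INF_superset_mono) auto

lemma cover_measure_mono:
  assumes "\<And>U. Q U \<Longrightarrow> P U" "\<And>U. Q U \<Longrightarrow> \<tau> U \<le> \<tau>' U"
  shows "cover_measure P \<tau> E \<le> cover_measure Q \<tau>' E"
  unfolding cover_measure_def by (rule INF_mono) (use assms in \<open>blast intro: suminf_le\<close>)

lemma cover_measure_UN:
  fixes X :: "nat \<Rightarrow> 'a set"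
  shows "cover_measure P \<tau> (\<Union>m. X m) \<le> (\<Sum>m. cover_measure P \<tau> (X m))"
proof (rule ennreal_le_epsilon)
  fix e :: real assume e_pos: "0 < e" and finite: "(\<Sum>m. cover_measure P \<tau> (X m)) < \<top>"
  have "\<exists>F. (\<forall>i::nat. P (F i)) \<and> X m \<subseteq> (\<Union>i. F i)
      \<and> (\<Sum>i. \<tau> (F i)) < cover_measure P \<tau> (X m) + ennreal (e * (1/2) ^ Suc m)" for m
  proof -
    have "cover_measure P \<tau> (X m) \<noteq> \<top>"
      using ennreal_suminf_lessD[OF finite] by (simp add: less_top)
    then have "cover_measure P \<tau> (X m) < cover_measure P \<tau> (X m) + ennreal (e * (1/2) ^ Suc m)"
      using ennreal_add_left_cancel_less[of "cover_measure P \<tau> (X m)" 0] e_pos by simp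
    then show ?thesis unfolding cover_measure_def INF_less_iff by auto
  qed
  then obtain F where F_P: "\<And>m i::nat. P (F m i)" and F_cover: "\<And>m. X m \<subseteq> (\<Union>i. F m i)"
      and F_sum: "\<And>m. (\<Sum>i. \<tau> (F m i)) < cover_measure P \<tau> (X m) + ennreal (e * (1/2) ^ Suc m)"
    by metis
  have cover: "(\<Union>m. X m) \<subseteq> (\<Union>k. case_prod F (prod_decode k))"
  proof
    fix x assume "x \<in> (\<Union>m. X m)"
    then obtain m i where "x \<in> F m i" using F_cover by blast
    then have "x \<in> case_prod F (prod_decode (prod_encode (m, i)))" by simp
    then show "x \<in> (\<Union>k. case_prod F (prod_decode k))" by (rule UN_I[OF UNIV_I])
  qed
  have "cover_measure P \<tau> (\<Union>m. X m) \<le> (\<Sum>k. \<tau> (case_prod F (prod_decode k)))"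
    by (rule cover_measure_le[OF _ cover]) (simp add: F_P split: prod.split)
  also have "\<dots> = (\<Sum>m. \<Sum>i. \<tau> (F m i))"
    using suminf_ennreal_2dimen[of _ "\<lambda>k. \<tau> (case_prod F k)"] by simp
  also have "\<dots> \<le> (\<Sum>m. cover_measure P \<tau> (X m) + ennreal (e * (1/2) ^ Suc m))"
    by (intro suminf_le less_imp_le F_sum) auto
  also have "\<dots> = (\<Sum>m. cover_measure P \<tau> (X m)) + (\<Sum>m. ennreal (e * (1/2) ^ Suc m))"
    by (rule suminf_add[symmetric]) auto
  also have "(\<Sum>m. ennreal (e * (1/2) ^ Suc m)) = ennreal e"
    using e_pos by (intro suminf_ennreal_power_half) simp
  finally show "cover_measure P \<tau> (\<Union>m. X m) \<le> (\<Sum>m. cover_measure P \<tau> (X m)) + ennreal e" .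
qed

lemma cover_measure_UN_eq_0:
  fixes X :: "nat \<Rightarrow> 'a set"
  assumes "\<And>m. cover_measure P \<tau> (X m) = 0"
  shows "cover_measure P \<tau> (\<Union>m. X m) = 0"
  using cover_measure_UN[of P \<tau> X] assms by simp

lemma cover_measure_le_infsum:
  assumes countable: "countable I" and empty: "P {}" "\<tau> {} = 0"
    and U_P: "\<And>i. i \<in> I \<Longrightarrow> P (U i)" and U_cover: "E \<subseteq> (\<Union>i\<in>I. U i)"
  shows "cover_measure P \<tau> E \<le> (\<Sum>\<^sub>\<infinity>i\<in>I. \<tau> (U i))"
proof -
  define F where "F n = (if n \<in> to_nat_on I ` I then U (from_nat_into I n) else {})" for n
  have "E \<subseteq> (\<Union>n. F n)"
  proof
    fix x assume "x \<in> E"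
    then obtain i where "i \<in> I" "x \<in> U i" using U_cover by blast
    then have "x \<in> F (to_nat_on I i)" using countable by (simp add: F_def)
    then show "x \<in> (\<Union>n. F n)" by blast
  qed
  moreover have "P (F n)" for n using U_P countable empty by (auto simp: F_def)
  ultimately have "cover_measure P \<tau> E \<le> (\<Sum>n. \<tau> (F n))" by (intro cover_measure_le)
  also have "\<dots> = (\<Sum>n. if n \<in> to_nat_on I ` I then \<tau> (U (from_nat_into I n)) else 0)"
    by (rule arg_cong[where f = suminf]) (auto simp: F_def empty)
  also have "\<dots> \<le> (\<Sum>\<^sub>\<infinity>i\<in>I. \<tau> (U i))" by (rule suminf_from_nat_into_le_infsum[OF countable])
  finally show ?thesis .
qed

lemma outer_measure_of_UN:
  fixes A :: "nat \<Rightarrow> 'a set"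
  assumes "\<And>i. A i \<subseteq> space M"
  shows "outer_measure_of M (\<Union>i. A i) \<le> (\<Sum>i. outer_measure_of M (A i))"
proof -
  obtain B where B_sets: "\<And>i. B i \<in> sets M" and A_subset: "\<And>i. A i \<subseteq> B i"
    and A_measure: "\<And>i. outer_measure_of M (A i) = emeasure M (B i)"
    using outer_measure_of_attain[OF assms] by metis
  have "outer_measure_of M (\<Union>i. A i) \<le> outer_measure_of M (\<Union>i. B i)"
    using A_subset by (intro outer_measure_of_mono UN_mono) auto
  also have "\<dots> = emeasure M (\<Union>i. B i)"
    by (rule outer_measure_of_eq) (use B_sets in blast)
  also have "\<dots> \<le> (\<Sum>i. emeasure M (B i))"
    using B_sets by (intro emeasure_subadditive_countably) auto
  finally show ?thesis by (simp add: A_measure)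
qed

lemma outer_measure_of_le_cover_measure:
  assumes A_subset: "A \<subseteq> space M" and c_pos: "0 < c"
    and bound: "\<And>U. P U \<Longrightarrow> outer_measure_of M (U \<inter> A) \<le> ennreal c * \<tau> U"
  shows "outer_measure_of M A \<le> ennreal c * cover_measure P \<tau> A"
  unfolding cover_measure_def
proof (rule le_cmult_INF_ennreal[OF c_pos])
  fix F :: "nat \<Rightarrow> 'a set"
  assume "F \<in> {F. (\<forall>i. P (F i)) \<and> A \<subseteq> (\<Union>i. F i)}"
  then have F_P: "\<And>i. P (F i)" and A_eq: "A = (\<Union>i. F i \<inter> A)" by auto
  have "outer_measure_of M A \<le> (\<Sum>i. outer_measure_of M (F i \<inter> A))"
    by (subst A_eq) (use A_subset in \<open>blast intro: outer_measure_of_UN\<close>)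
  also have "\<dots> \<le> (\<Sum>i. ennreal c * \<tau> (F i))"
    by (intro suminf_le bound F_P) auto
  also have "\<dots> = ennreal c * (\<Sum>i. \<tau> (F i))" by simp
  finally show "outer_measure_of M A \<le> ennreal c * (\<Sum>i. \<tau> (F i))" .
qed

lemma outer_measure_of_le_infsum:
  assumes "countable I" "A \<subseteq> (\<Union>i\<in>I. U i)" "A \<subseteq> space M"
  shows "outer_measure_of M A \<le> (\<Sum>\<^sub>\<infinity>i\<in>I. outer_measure_of M (U i))"
proof -
  have "outer_measure_of M A \<le> ennreal 1 * cover_measure (\<lambda>_. True) (outer_measure_of M) A"
    using assms(3) by (rule outer_measure_of_le_cover_measure) (auto intro: outer_measure_of_mono)
  also have "\<dots> \<le> (\<Sum>\<^sub>\<infinity>i\<in>I. outer_measure_of M (U i))"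
    using cover_measure_le_infsum[OF assms(1), of "\<lambda>_. True" "outer_measure_of M"] assms(2) by simp
  finally show ?thesis .
qed

lemma emeasure_space_le_outer_measure_of:
  assumes "AE x in M. x \<in> A"
  shows "emeasure M (space M) \<le> outer_measure_of M A"
  unfolding outer_measure_of_def
proof (rule INF_greatest)
  fix B assume B_cover: "B \<in> {B \<in> sets M. A \<subseteq> B}"
  have "AE x in M. x \<in> space M \<longrightarrow> x \<in> B" using assms by eventually_elim (use B_cover in blast)
  then show "emeasure M (space M) \<le> emeasure M B" using B_cover by (intro emeasure_mono_AE) auto
qed

section \<open>Hausdorff and packing measures\<close>

lemma hausdorff_pre_eq_cover_measure:
  "hausdorff_pre s \<delta> = cover_measure (\<lambda>U. bounded U \<and> diameter U \<le> \<delta>) (diam_pow s)"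
  by (simp add: fun_eq_iff hausdorff_pre_def cover_measure_def)

lemma packing_measure_eq_cover_measure: "packing_measure s = cover_measure (\<lambda>_. True) (packing_pre s)"
  by (simp add: fun_eq_iff packing_measure_def cover_measure_def)

lemma mf_packing_eq_cover_measure: "mf_packing \<mu> q t = cover_measure (\<lambda>_. True) (mf_packing_pre \<mu> q t)"
  by (simp add: fun_eq_iff mf_packing_def cover_measure_def)

lemma hausdorff_pre_antimono: "\<delta> \<le> \<delta>' \<Longrightarrow> hausdorff_pre s \<delta>' E \<le> hausdorff_pre s \<delta> E"
  unfolding hausdorff_pre_eq_cover_measure by (rule cover_measure_mono) auto

lemma hausdorff_measure_eq_SUP: "hausdorff_measure s E = (SUP \<delta>\<in>{0<..}. hausdorff_pre s \<delta> E)"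
  unfolding hausdorff_measure_def
  by (intro Lim_at_right_eq_SUP) (auto simp: monotone_on_def hausdorff_pre_antimono)

lemma hausdorff_pre_le_hausdorff_measure: "0 < \<delta> \<Longrightarrow> hausdorff_pre s \<delta> E \<le> hausdorff_measure s E"
  unfolding hausdorff_measure_eq_SUP by (rule SUP_upper) simp

lemma hausdorff_measure_leI:
  assumes "0 < \<delta>\<^sub>0" "\<And>\<delta>. 0 < \<delta> \<Longrightarrow> \<delta> \<le> \<delta>\<^sub>0 \<Longrightarrow> hausdorff_pre s \<delta> E \<le> c"
  shows "hausdorff_measure s E \<le> c"
  unfolding hausdorff_measure_eq_SUP
proof (rule SUP_least)
  fix \<delta> :: real assume "\<delta> \<in> {0<..}"
  have "hausdorff_pre s \<delta> E \<le> hausdorff_pre s (min \<delta> \<delta>\<^sub>0) E"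
    by (rule hausdorff_pre_antimono) simp
  also have "\<dots> \<le> c" using assms \<open>\<delta> \<in> {0<..}\<close> by simp
  finally show "hausdorff_pre s \<delta> E \<le> c" .
qed

lemma hausdorff_measure_subset: "E \<subseteq> E' \<Longrightarrow> hausdorff_measure s E \<le> hausdorff_measure s E'"
  unfolding hausdorff_measure_eq_SUP hausdorff_pre_eq_cover_measure
  by (intro SUP_mono) (blast intro: cover_measure_subset)

lemma hausdorff_measure_UN_eq_0:
  fixes X :: "nat \<Rightarrow> 'a::metric_space set"
  assumes "\<And>m. hausdorff_measure s (X m) = 0"
  shows "hausdorff_measure s (\<Union>m. X m) = 0"
proof -
  have "hausdorff_pre s \<delta> (\<Union>m. X m) = 0" if "0 < \<delta>" for \<delta>
    unfolding hausdorff_pre_eq_cover_measure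
  proof (rule cover_measure_UN_eq_0)
    fix m
    have "hausdorff_pre s \<delta> (X m) \<le> 0"
      using hausdorff_pre_le_hausdorff_measure[OF that] assms by metis
    then show "cover_measure (\<lambda>U. bounded U \<and> diameter U \<le> \<delta>) (diam_pow s) (X m) = 0"
      by (simp add: hausdorff_pre_eq_cover_measure)
  qed
  then show ?thesis using hausdorff_measure_leI[of 1 s "\<Union>m. X m" 0] by simp
qed

lemma hausdorff_measure_antimono_exponent:
  assumes exponents: "0 \<le> s" "s \<le> s'"
  shows "hausdorff_measure s' E \<le> hausdorff_measure s E"
proof (rule hausdorff_measure_leI)
  fix \<delta> :: real assume \<delta>_bounds: "0 < \<delta>" "\<delta> \<le> 1"
  have "diam_pow s' U \<le> diam_pow s U" if "bounded U" "diameter U \<le> \<delta>" for U :: "'a set"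
    using exponents \<delta>_bounds that diameter_ge_0[OF that(1)]
    by (auto simp: diam_pow_def intro!: ennreal_leI powr_mono' powr_le1)
  then have "hausdorff_pre s' \<delta> E \<le> hausdorff_pre s \<delta> E"
    unfolding hausdorff_pre_eq_cover_measure by (intro cover_measure_mono) auto
  also have "\<dots> \<le> hausdorff_measure s E" by (rule hausdorff_pre_le_hausdorff_measure[OF \<delta>_bounds(1)])
  finally show "hausdorff_pre s' \<delta> E \<le> hausdorff_measure s E" .
qed simp

lemma le_hausdorff_dimI:
  assumes "\<And>s. 0 < s \<Longrightarrow> s < h \<Longrightarrow> hausdorff_measure s E \<noteq> 0"
  shows "ereal h \<le> hausdorff_dim E"
  unfolding hausdorff_dim_def
proof (rule le_Inf_ereal_Collect, safe)
  fix s assume "s < h" "0 \<le> s" and zero: "hausdorff_measure s E = 0"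
  then obtain s' where "s < s'" "s' < h" using dense by blast
  then have "hausdorff_measure s' E \<le> 0"
    using hausdorff_measure_antimono_exponent[of s s' E] zero \<open>0 \<le> s\<close> \<open>s < s'\<close> by simp
  then show False using assms[of s'] \<open>0 \<le> s\<close> \<open>s < s'\<close> \<open>s' < h\<close> by simp
qed

lemma hausdorff_dim_leI:
  assumes "\<And>s. 0 < s \<Longrightarrow> h < s \<Longrightarrow> hausdorff_measure s E = 0"
  shows "hausdorff_dim E \<le> ereal (max 0 h)"
  unfolding hausdorff_dim_def by (rule Inf_ereal_Collect_le) (use assms in auto)

lemma le_packing_dimI:
  assumes "\<And>s. s < h \<Longrightarrow> packing_measure s E \<noteq> 0"
  shows "ereal h \<le> packing_dim E"
  unfolding packing_dim_def by (rule le_Inf_ereal_Collect) (use assms in auto)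

lemma packing_dim_leI:
  assumes "\<And>s. 0 < s \<Longrightarrow> h < s \<Longrightarrow> packing_measure s E = 0"
  shows "packing_dim E \<le> ereal (max 0 h)"
  unfolding packing_dim_def by (rule Inf_ereal_Collect_le) (use assms in auto)

lemma packing_pre_delta_mono:
  "E \<subseteq> E' \<Longrightarrow> \<delta> \<le> \<delta>' \<Longrightarrow> packing_pre_delta s \<delta> E \<le> packing_pre_delta s \<delta>' E'"
  unfolding packing_pre_delta_def delta_packing_def by (rule SUP_subset_mono) force+

lemma packing_pre_eq_INF: "packing_pre s E = (INF \<delta>\<in>{0<..}. packing_pre_delta s \<delta> E)"
  unfolding packing_pre_def
  by (intro Lim_at_right_eq_INF) (auto simp: monotone_on_def packing_pre_delta_mono)

subsection \<open>The mass distribution principle\<close>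

lemma measure_singleton_eq_0_of_powr_bound:
  fixes x :: "'a::metric_space"
  assumes finite_N: "finite_measure N" and sets_N: "sets N = sets borel" and s_pos: "0 < s"
    and \<delta>_pos: "0 < \<delta>"
    and bound: "\<And>r. 0 < r \<Longrightarrow> r \<le> \<delta> \<Longrightarrow> measure N (cball x r) \<le> C * r powr s"
  shows "measure N {x} = 0"
proof -
  interpret finite_measure N by (rule finite_N)
  have "((\<lambda>r. C * r powr s) \<longlongrightarrow> C * 0) (at_right 0)"
    using s_pos by (intro tendsto_mult tendsto_const) real_asymp
  moreover have "\<forall>\<^sub>F r in at_right 0. measure N {x} \<le> C * r powr s"
    using eventually_at_right_real[OF \<delta>_pos]
  proof eventually_elim
    case (elim r)
    then have "measure N {x} \<le> measure N (cball x r)"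
      by (intro finite_measure_mono) (auto simp: sets_N)
    also have "\<dots> \<le> C * r powr s" using elim by (intro bound) auto
    finally show ?case .
  qed
  ultimately have "measure N {x} \<le> C * 0" by (rule tendsto_lowerbound) simp
  then show ?thesis using measure_nonneg[of N "{x}"] by simp
qed

lemma outer_measure_of_le_diam_pow:
  fixes U :: "'a::metric_space set"
  assumes finite_N: "finite_measure N" and sets_N: "sets N = sets borel" and s_pos: "0 < s"
    and \<delta>_pos: "0 < \<delta>"
    and bound: "\<And>x r. x \<in> A \<Longrightarrow> 0 < r \<Longrightarrow> r \<le> \<delta> \<Longrightarrow> measure N (cball x r) \<le> C * r powr s"
    and U_bounded: "bounded U" and U_diameter: "diameter U \<le> \<delta>"
  shows "outer_measure_of N (U \<inter> A) \<le> ennreal C * diam_pow s U"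
proof (cases "U \<inter> A = {}")
  case True
  then show ?thesis using sets.empty_sets[of N] by simp
next
  case False
  interpret finite_measure N by (rule finite_N)
  define d where "d = diameter U"
  obtain x where "x \<in> U" "x \<in> A" using False by blast
  have "0 \<le> d" "d \<le> \<delta>" using diameter_ge_0[OF U_bounded] U_diameter by (simp_all add: d_def)
  have mass: "measure N (cball x d) \<le> C * d powr s"
  proof (cases "d = 0")
    case True
    then show ?thesis
      using measure_singleton_eq_0_of_powr_bound[OF finite_N sets_N s_pos \<delta>_pos bound[OF \<open>x \<in> A\<close>]]
      by simp
  next
    case False
    then show ?thesis using bound[OF \<open>x \<in> A\<close>] \<open>0 \<le> d\<close> \<open>d \<le> \<delta>\<close> by simp
  qed
  have "U \<inter> A \<subseteq> cball x d"
    using diameter_bounded_bound[OF U_bounded \<open>x \<in> U\<close>] by (auto simp: d_def)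
  then have "outer_measure_of N (U \<inter> A) \<le> outer_measure_of N (cball x d)"
    by (rule outer_measure_of_mono)
  also have "\<dots> \<le> ennreal (C * d powr s)"
    using mass by (simp add: sets_N emeasure_eq_measure ennreal_leI)
  also have "\<dots> = ennreal C * diam_pow s U"
    using s_pos \<open>x \<in> U\<close> by (auto simp: diam_pow_def d_def ennreal_mult'')
  finally show ?thesis .
qed

lemma outer_measure_of_le_hausdorff_measure:
  fixes A :: "'a::metric_space set"
  assumes finite_N: "finite_measure N" and sets_N: "sets N = sets borel"
    and s_pos: "0 < s" and \<delta>_pos: "0 < \<delta>" and C_pos: "0 < C"
    and bound: "\<And>x r. x \<in> A \<Longrightarrow> 0 < r \<Longrightarrow> r \<le> \<delta> \<Longrightarrow> measure N (cball x r) \<le> C * r powr s"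
  shows "outer_measure_of N A \<le> ennreal C * hausdorff_measure s A"
proof -
  have "outer_measure_of N A \<le> ennreal C * hausdorff_pre s \<delta> A"
    unfolding hausdorff_pre_eq_cover_measure
  proof (rule outer_measure_of_le_cover_measure[OF _ C_pos])
    show "A \<subseteq> space N" using sets_eq_imp_space_eq[OF sets_N] by simp
  qed (use outer_measure_of_le_diam_pow[OF finite_N sets_N s_pos \<delta>_pos bound] in auto)
  also have "\<dots> \<le> ennreal C * hausdorff_measure s A"
    by (intro mult_left_mono hausdorff_pre_le_hausdorff_measure[OF \<delta>_pos]) simp
  finally show ?thesis .
qed

lemma diameter_ball_le:
  fixes x :: "'a::metric_space"
  assumes "0 < r"
  shows "diameter (ball x r) \<le> 2 * r"
proof -
  have "dist y z \<le> 2 * r" if "y \<in> ball x r" "z \<in> ball x r" for y z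
    using that dist_triangle3[of y z x] by simp
  then show ?thesis
    unfolding diameter_def using assms by (auto intro!: cSUP_least)
qed

section \<open>Multifractal measures\<close>

definition mf_gauge :: "'a::metric_space measure \<Rightarrow> real \<Rightarrow> real \<Rightarrow> 'a \<Rightarrow> real \<Rightarrow> real" where
  "mf_gauge \<mu> q t x r = r powr t * measure \<mu> (ball x r) powr q"

lemma mf_gauge_nonneg [simp]: "0 \<le> mf_gauge \<mu> q t x r"
  by (simp add: mf_gauge_def)

text \<open>As \<open>0 powr q = 0\<close> even for \<open>q \<le> 0\<close>, balls of measure zero need not be excluded from the sum.\<close>

lemma mf_sum_eq_infsum_mf_gauge: "mf_sum \<mu> q t \<B> = (\<Sum>\<^sub>\<infinity>(x, r)\<in>\<B>. ennreal (mf_gauge \<mu> q t x r))"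
  unfolding mf_sum_def mf_gauge_def by (rule infsum_cong_neutral) auto

lemma mf_sum_image:
  "mf_sum \<mu> q t ((\<lambda>x. (x, \<rho> x)) ` T) = (\<Sum>\<^sub>\<infinity>x\<in>T. ennreal (mf_gauge \<mu> q t x (\<rho> x)))"
  unfolding mf_sum_eq_infsum_mf_gauge
  by (subst infsum_reindex) (auto simp: inj_on_def comp_def)

lemma mf_packing_pre_delta_mono:
  "E \<subseteq> E' \<Longrightarrow> \<delta> \<le> \<delta>' \<Longrightarrow> mf_packing_pre_delta \<mu> q t \<delta> E \<le> mf_packing_pre_delta \<mu> q t \<delta>' E'"
  unfolding mf_packing_pre_delta_def delta_packing_def by (rule SUP_subset_mono) force+

lemma mf_packing_pre_eq_INF:
  "mf_packing_pre \<mu> q t E = (INF \<delta>\<in>{0<..}. mf_packing_pre_delta \<mu> q t \<delta> E)"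
  unfolding mf_packing_pre_def
  by (intro Lim_at_right_eq_INF) (auto simp: monotone_on_def mf_packing_pre_delta_mono)

lemma mf_packing_pre_subset:
  "E \<subseteq> E' \<Longrightarrow> mf_packing_pre \<mu> q t E \<le> mf_packing_pre \<mu> q t E'"
  unfolding mf_packing_pre_eq_INF by (intro INF_mono) (blast intro: mf_packing_pre_delta_mono)

lemma mf_hausdorff_pre_eq_SUP:
  "mf_hausdorff_pre \<mu> q t E = (SUP \<delta>\<in>{0<..}. mf_hausdorff_pre_delta \<mu> q t \<delta> E)"
proof -
  have "mf_hausdorff_pre_delta \<mu> q t \<delta>' E \<le> mf_hausdorff_pre_delta \<mu> q t \<delta> E" if "\<delta> \<le> \<delta>'" for \<delta> \<delta>'
    unfolding mf_hausdorff_pre_delta_def centered_cover_def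
    by (rule INF_superset_mono) (use that in force)+
  then show ?thesis
    unfolding mf_hausdorff_pre_def by (intro Lim_at_right_eq_SUP) (auto simp: monotone_on_def)
qed

lemma mf_hausdorff_pre_delta_le_mf_hausdorff:
  assumes "F \<subseteq> E" "0 < \<delta>"
  shows "mf_hausdorff_pre_delta \<mu> q t \<delta> F \<le> mf_hausdorff \<mu> q t E"
  unfolding mf_hausdorff_def mf_hausdorff_pre_eq_SUP
  using assms by (intro SUP_upper2[of F] SUP_upper) auto

lemma mf_packing_eq_0I:
  assumes "mf_packing_pre \<mu> q t E = 0"
  shows "mf_packing \<mu> q t E = 0"
  unfolding mf_packing_eq_cover_measure
  using cover_measure_le[of "\<lambda>_. True" "\<lambda>_. E" E "mf_packing_pre \<mu> q t"] assms by simp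

lemma mf_packing_0_le_packing_measure: "mf_packing \<mu> 0 s E \<le> packing_measure s E"
proof -
  have "(\<Sum>\<^sub>\<infinity>(x, r)\<in>\<B>. ennreal (mf_gauge \<mu> 0 s x r)) \<le> (\<Sum>\<^sub>\<infinity>(x, r)\<in>\<B>. ennreal (r powr s))" for \<B>
    by (rule infsum_mono_ennreal) (auto simp: mf_gauge_def intro!: ennreal_leI)
  then have "mf_packing_pre_delta \<mu> 0 s \<delta> F \<le> packing_pre_delta s \<delta> F" for \<delta> F
    unfolding mf_packing_pre_delta_def packing_pre_delta_def mf_sum_eq_infsum_mf_gauge
    by (rule SUP_mono')
  then have "mf_packing_pre \<mu> 0 s F \<le> packing_pre s F" for F
    unfolding mf_packing_pre_eq_INF packing_pre_eq_INF by (intro INF_mono) blast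
  then show ?thesis
    unfolding mf_packing_eq_cover_measure packing_measure_eq_cover_measure
    by (intro cover_measure_mono) auto
qed

subsection \<open>Upper bounds for the dimensions of the level sets\<close>

definition mf_regular :: "'a::metric_space measure \<Rightarrow> real \<Rightarrow> real \<Rightarrow> real \<Rightarrow> real \<Rightarrow> 'a set" where
  "mf_regular \<mu> q t s \<delta> = {x. \<forall>r\<in>{0<..\<delta>}. r powr s \<le> mf_gauge \<mu> q t x r}"

lemma hausdorff_pre_le_infsum_centered_cover:
  assumes s_pos: "0 < s" and \<delta>_pos: "0 < \<delta>" and countable: "countable \<B>"
    and cover: "centered_cover \<delta> E \<B>"
  shows "hausdorff_pre s (2 * \<delta>) E \<le> (\<Sum>\<^sub>\<infinity>(x, r)\<in>\<B>. ennreal ((2 * r) powr s))"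
proof -
  have radius: "0 < snd b" "snd b \<le> \<delta>" if "b \<in> \<B>" for b
    using that cover by (auto simp: centered_cover_def)
  have "hausdorff_pre s (2 * \<delta>) E \<le> (\<Sum>\<^sub>\<infinity>b\<in>\<B>. diam_pow s (ball (fst b) (snd b)))"
    unfolding hausdorff_pre_eq_cover_measure
  proof (rule cover_measure_le_infsum[OF countable])
    show "bounded (ball (fst b) (snd b)) \<and> diameter (ball (fst b) (snd b)) \<le> 2 * \<delta>" if "b \<in> \<B>" for b
      using diameter_ball_le[of "snd b" "fst b"] radius[OF that] by simp
    show "E \<subseteq> (\<Union>b\<in>\<B>. ball (fst b) (snd b))"
      using cover by (simp add: centered_cover_def split_beta)
  qed (use \<delta>_pos in \<open>auto simp: diam_pow_def\<close>)
  also have "\<dots> \<le> (\<Sum>\<^sub>\<infinity>(x, r)\<in>\<B>. ennreal ((2 * r) powr s))"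
  proof (rule infsum_mono_ennreal)
    fix b assume "b \<in> \<B>"
    then show "diam_pow s (ball (fst b) (snd b)) \<le> (case b of (x, r) \<Rightarrow> ennreal ((2 * r) powr s))"
      using s_pos radius(1) diameter_ball_le[of "snd b" "fst b"] diameter_ge_0[of "ball (fst b) (snd b)"]
      by (auto simp: diam_pow_def split_beta intro!: ennreal_leI powr_mono2)
  qed
  finally show ?thesis .
qed

lemma hausdorff_pre_le_mf_hausdorff_pre_delta:
  assumes s_pos: "0 < s" and \<delta>_pos: "0 < \<delta>" and regular: "E \<subseteq> mf_regular \<mu> q t s \<delta>"
  shows "hausdorff_pre s (2 * \<delta>) E \<le> ennreal (2 powr s) * mf_hausdorff_pre_delta \<mu> q t \<delta> E"
  unfolding mf_hausdorff_pre_delta_def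
proof (rule le_cmult_INF_ennreal)
  fix \<B> assume "\<B> \<in> {\<B>. centered_cover \<delta> E \<B>}"
  then have cover: "centered_cover \<delta> E \<B>" by simp
  have ball: "x \<in> E" "0 < r" "r \<le> \<delta>" if "(x, r) \<in> \<B>" for x r
    using cover that by (auto simp: centered_cover_def)
  have gauge: "r powr s \<le> mf_gauge \<mu> q t x r" if "(x, r) \<in> \<B>" for x r
    using ball[OF that] regular by (auto simp: mf_regular_def)
  have gauge_pos: "0 < mf_gauge \<mu> q t x r" if "(x, r) \<in> \<B>" for x r
    using ball(2)[OF that] by (intro less_le_trans[OF _ gauge[OF that]]) simp
  show "hausdorff_pre s (2 * \<delta>) E \<le> ennreal (2 powr s) * mf_sum \<mu> q t \<B>"
  proof (cases "mf_sum \<mu> q t \<B> = \<top>")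
    case True
    then show ?thesis by (simp add: ennreal_mult_top)
  next
    case False
    have "countable \<B>"
    proof (rule countable_of_infsum_ennreal)
      show "(\<Sum>\<^sub>\<infinity>(x, r)\<in>\<B>. ennreal (mf_gauge \<mu> q t x r)) \<noteq> \<top>"
        using False by (simp add: mf_sum_eq_infsum_mf_gauge)
      show "(case b of (x, r) \<Rightarrow> ennreal (mf_gauge \<mu> q t x r)) \<noteq> 0" if "b \<in> \<B>" for b
        using gauge_pos[of "fst b" "snd b"] that by (auto simp: ennreal_eq_0_iff split_beta)
    qed
    then have "hausdorff_pre s (2 * \<delta>) E \<le> (\<Sum>\<^sub>\<infinity>(x, r)\<in>\<B>. ennreal ((2 * r) powr s))"
      by (rule hausdorff_pre_le_infsum_centered_cover[OF s_pos \<delta>_pos _ cover])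
    also have "\<dots> \<le> (\<Sum>\<^sub>\<infinity>(x, r)\<in>\<B>. ennreal (2 powr s) * ennreal (mf_gauge \<mu> q t x r))"
      by (rule infsum_mono_ennreal)
         (auto simp: powr_mult simp flip: ennreal_mult intro!: ennreal_leI gauge)
    also have "\<dots> \<le> ennreal (2 powr s) * mf_sum \<mu> q t \<B>"
      unfolding mf_sum_eq_infsum_mf_gauge split_beta by (rule infsum_cmult_le_ennreal)
    finally show ?thesis .
  qed
qed simp

lemma packing_pre_delta_le_mf_packing_pre_delta:
  assumes "\<delta> \<le> \<delta>\<^sub>0" "E \<subseteq> mf_regular \<mu> q t s \<delta>\<^sub>0"
  shows "packing_pre_delta s \<delta> E \<le> mf_packing_pre_delta \<mu> q t \<delta> E"
  unfolding packing_pre_delta_def mf_packing_pre_delta_def mf_sum_eq_infsum_mf_gauge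
proof (rule SUP_mono)
  fix \<B> assume packing: "\<B> \<in> {\<B>. delta_packing \<delta> E \<B>}"
  have "(\<Sum>\<^sub>\<infinity>(x, r)\<in>\<B>. ennreal (r powr s)) \<le> (\<Sum>\<^sub>\<infinity>(x, r)\<in>\<B>. ennreal (mf_gauge \<mu> q t x r))"
  proof (rule infsum_mono_ennreal, clarify)
    fix x r assume "(x, r) \<in> \<B>"
    then have "x \<in> E" "0 < r" "r \<le> \<delta>" using packing by (auto simp: delta_packing_def)
    then have "r powr s \<le> mf_gauge \<mu> q t x r" using assms by (auto simp: mf_regular_def)
    then show "ennreal (r powr s) \<le> ennreal (mf_gauge \<mu> q t x r)" by (rule ennreal_leI)
  qed
  with packing show "\<exists>\<B>'\<in>{\<B>. delta_packing \<delta> E \<B>}. (\<Sum>\<^sub>\<infinity>(x, r)\<in>\<B>. ennreal (r powr s))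
      \<le> (\<Sum>\<^sub>\<infinity>(x, r)\<in>\<B>'. ennreal (mf_gauge \<mu> q t x r))" by blast
qed

lemma packing_measure_le_mf_packing:
  assumes "0 < \<delta>" and regular: "E \<subseteq> mf_regular \<mu> q t s \<delta>"
  shows "packing_measure s E \<le> mf_packing \<mu> q t E"
proof -
  have pre_le: "packing_pre s F \<le> mf_packing_pre \<mu> q t F" if "F \<subseteq> mf_regular \<mu> q t s \<delta>" for F
    unfolding packing_pre_eq_INF mf_packing_pre_eq_INF
  proof (rule INF_mono)
    fix d :: real assume "d \<in> {0<..}"
    have "packing_pre_delta s (min d \<delta>) F \<le> mf_packing_pre_delta \<mu> q t (min d \<delta>) F"
      using that by (intro packing_pre_delta_le_mf_packing_pre_delta) auto
    also have "\<dots> \<le> mf_packing_pre_delta \<mu> q t d F"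
      by (rule mf_packing_pre_delta_mono) auto
    finally show "\<exists>d'\<in>{0<..}. packing_pre_delta s d' F \<le> mf_packing_pre_delta \<mu> q t d F"
      using assms(1) \<open>d \<in> {0<..}\<close> by (intro bexI[of _ "min d \<delta>"]) auto
  qed
  show ?thesis
    unfolding mf_packing_def
  proof (rule INF_greatest)
    fix F :: "nat \<Rightarrow> 'a set" assume "F \<in> {F. E \<subseteq> (\<Union>i. F i)}"
    then have "packing_measure s E \<le> (\<Sum>i. packing_pre s (F i \<inter> E))"
      unfolding packing_measure_eq_cover_measure by (intro cover_measure_le) auto
    also have "\<dots> \<le> (\<Sum>i. mf_packing_pre \<mu> q t (F i))"
      by (intro suminf_le order.trans[OF pre_le mf_packing_pre_subset]) (use regular in auto)
    finally show "packing_measure s E \<le> (\<Sum>i. mf_packing_pre \<mu> q t (F i))" .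
  qed
qed

lemma measure_ball_pos_msupport:
  assumes "finite_measure \<mu>" "x \<in> msupport \<mu>" "0 < r"
  shows "0 < measure \<mu> (ball x r)"
proof -
  interpret finite_measure \<mu> by (rule assms)
  have "x \<in> ball x r" using assms(3) by simp
  then have "emeasure \<mu> (ball x r) \<noteq> 0"
    using assms(2,3) unfolding msupport_def by blast
  then show ?thesis by (simp add: emeasure_eq_measure less_le)
qed

lemma level_set_subset_mf_regular:
  assumes finite_\<mu>: "finite_measure \<mu>" and less_s: "t + \<alpha> * q < s"
  shows "level_set \<mu> \<alpha> \<inter> msupport \<mu> \<subseteq> (\<Union>m. mf_regular \<mu> q t s (1 / real (Suc m)))"
proof
  fix x assume x_level: "x \<in> level_set \<mu> \<alpha> \<inter> msupport \<mu>"
  define v where "v r = ln (measure \<mu> (ball x r)) / ln r" for r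
  have "(v \<longlongrightarrow> \<alpha>) (at_right 0)" using x_level by (simp add: level_set_def v_def[abs_def])
  then have "((\<lambda>r. t + v r * q) \<longlongrightarrow> t + \<alpha> * q) (at_right 0)"
    by (intro tendsto_intros)
  then have "\<forall>\<^sub>F r in at_right 0. t + v r * q < s"
    using less_s by (rule order_tendstoD)
  then obtain d where "d > 0" and less_d: "\<And>r. 0 < r \<Longrightarrow> r < d \<Longrightarrow> t + v r * q < s"
    unfolding eventually_at_right_field by auto
  obtain m where m_less: "inverse (real (Suc m)) < min d 1"
    using reals_Archimedean[of "min d 1"] \<open>d > 0\<close> by auto
  have "r powr s \<le> mf_gauge \<mu> q t x r" if r: "0 < r" "r \<le> 1 / real (Suc m)" for r
  proof -
    have "r < d" "r < 1" using r(2) m_less unfolding inverse_eq_divide by linarith+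
    then have "ln r < 0" using r by simp
    have ball_pos: "0 < measure \<mu> (ball x r)"
      using x_level r by (intro measure_ball_pos_msupport[OF finite_\<mu>]) auto
    have "s * ln r \<le> (t + v r * q) * ln r"
      using less_d[OF r(1) \<open>r < d\<close>] \<open>ln r < 0\<close> by (intro mult_right_mono_neg) auto
    also have "\<dots> = t * ln r + q * ln (measure \<mu> (ball x r))"
      using \<open>ln r < 0\<close> by (simp add: v_def algebra_simps)
    finally have "exp (s * ln r) \<le> exp (t * ln r) * exp (q * ln (measure \<mu> (ball x r)))"
      by (simp flip: exp_add)
    then show ?thesis using r ball_pos by (simp add: mf_gauge_def powr_def)
  qed
  then have "x \<in> mf_regular \<mu> q t s (1 / real (Suc m))" by (simp add: mf_regular_def)
  then show "x \<in> (\<Union>m. mf_regular \<mu> q t s (1 / real (Suc m)))" by blast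
qed

lemma hausdorff_measure_level_set_eq_0:
  assumes finite_\<mu>: "finite_measure \<mu>" and zero: "mf_hausdorff \<mu> q t (msupport \<mu>) = 0"
    and s_pos: "0 < s" and less_s: "t + \<alpha> * q < s"
  shows "hausdorff_measure s (level_set \<mu> \<alpha> \<inter> msupport \<mu>) = 0"
proof -
  define X where "X m = mf_regular \<mu> q t s (1 / real (Suc m)) \<inter> msupport \<mu>" for m
  have "hausdorff_measure s (X m) \<le> 0" for m
  proof (rule hausdorff_measure_leI)
    fix \<delta> :: real assume \<delta>_bounds: "0 < \<delta>" "\<delta> \<le> 2 * (1 / real (Suc m))"
    then have regular: "X m \<subseteq> mf_regular \<mu> q t s (\<delta> / 2)" by (auto simp: X_def mf_regular_def)
    have "hausdorff_pre s \<delta> (X m) \<le> ennreal (2 powr s) * mf_hausdorff_pre_delta \<mu> q t (\<delta> / 2) (X m)"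
      using hausdorff_pre_le_mf_hausdorff_pre_delta[OF s_pos _ regular] \<delta>_bounds(1) by simp
    also have "\<dots> \<le> ennreal (2 powr s) * mf_hausdorff \<mu> q t (msupport \<mu>)"
      using \<delta>_bounds(1)
      by (intro mult_left_mono mf_hausdorff_pre_delta_le_mf_hausdorff) (auto simp: X_def)
    finally show "hausdorff_pre s \<delta> (X m) \<le> 0" by (simp add: zero)
  qed simp
  then have "hausdorff_measure s (\<Union>m. X m) = 0" by (intro hausdorff_measure_UN_eq_0) simp
  moreover have "level_set \<mu> \<alpha> \<inter> msupport \<mu> \<subseteq> (\<Union>m. X m)"
    using level_set_subset_mf_regular[OF finite_\<mu> less_s] by (auto simp: X_def)
  ultimately show ?thesis using hausdorff_measure_subset[of _ "\<Union>m. X m" s] by fastforce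
qed

lemma packing_measure_level_set_eq_0:
  assumes finite_\<mu>: "finite_measure \<mu>" and zero: "mf_packing \<mu> q t (msupport \<mu>) = 0"
    and less_s: "t + \<alpha> * q < s"
  shows "packing_measure s (level_set \<mu> \<alpha> \<inter> msupport \<mu>) = 0"
proof -
  define X where "X m = mf_regular \<mu> q t s (1 / real (Suc m)) \<inter> msupport \<mu>" for m
  have "packing_measure s (X m) \<le> 0" for m
  proof -
    have "packing_measure s (X m) \<le> mf_packing \<mu> q t (X m)"
      by (rule packing_measure_le_mf_packing[of "1 / real (Suc m)"]) (auto simp: X_def)
    also have "\<dots> \<le> mf_packing \<mu> q t (msupport \<mu>)"
      unfolding mf_packing_eq_cover_measure by (rule cover_measure_subset) (auto simp: X_def)
    finally show ?thesis by (simp add: zero)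
  qed
  then have "packing_measure s (\<Union>m. X m) = 0"
    unfolding packing_measure_eq_cover_measure by (intro cover_measure_UN_eq_0) simp
  moreover have "level_set \<mu> \<alpha> \<inter> msupport \<mu> \<subseteq> (\<Union>m. X m)"
    using level_set_subset_mf_regular[OF finite_\<mu> less_s] by (auto simp: X_def)
  ultimately show ?thesis
    using cover_measure_subset[of _ "\<Union>m. X m" "\<lambda>_. True" "packing_pre s"]
    unfolding packing_measure_eq_cover_measure by fastforce
qed

theorem hausdorff_dim_level_set_le:
  assumes "finite_measure \<mu>"
  shows "hausdorff_dim (level_set \<mu> \<alpha> \<inter> msupport \<mu>) \<le> max 0 (mf_b \<mu> (msupport \<mu>) q + ereal (\<alpha> * q))"
  unfolding mf_b_def
  by (intro le_max_0_Inf_plus hausdorff_dim_leI hausdorff_measure_level_set_eq_0[OF assms])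

theorem packing_dim_level_set_le:
  assumes "finite_measure \<mu>"
  shows "packing_dim (level_set \<mu> \<alpha> \<inter> msupport \<mu>) \<le> max 0 (mf_B \<mu> (msupport \<mu>) q + ereal (\<alpha> * q))"
  unfolding mf_B_def
  by (intro le_max_0_Inf_plus packing_dim_leI packing_measure_level_set_eq_0[OF assms])

section \<open>Cylinders and balls\<close>

lemma mem_cylinder_coord [simp]: "x \<in> cylinder (coord x) n"
  by (simp add: cylinder_def)

lemma mem_cylinder_coord_iff: "y \<in> cylinder (coord x) n \<longleftrightarrow> dist x y \<le> (1/2) ^ n"
  unfolding cylinder_def dist_cantor_le_iff by auto

lemma cylinder_eq_of_mem: "y \<in> cylinder \<epsilon> n \<Longrightarrow> cylinder (coord y) n = cylinder \<epsilon> n"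
  by (auto simp: cylinder_def)

lemma cylinder_eq_of_mem_le:
  assumes "m \<le> n" "z \<in> cylinder (coord x) m" "z \<in> cylinder (coord y) n"
  shows "cylinder (coord x) m = cylinder (coord y) m"
  using assms by (auto simp: cylinder_def)

lemma cylinder_nonempty: "cylinder \<epsilon> n \<noteq> {}"
proof -
  have "coord (Abs_cantor (restrict \<epsilon> {1..})) = restrict \<epsilon> {1..}"
    by (rule Abs_cantor_inverse) auto
  then have "Abs_cantor (restrict \<epsilon> {1..}) \<in> cylinder \<epsilon> n" by (auto simp: cylinder_def)
  then show ?thesis by blast
qed

lemma coord_eq_of_mem_cylinder:
  assumes "y \<in> cylinder (coord x) j"
  shows "coord y j = coord x j"
proof (cases "j = 0")
  case True
  then show ?thesis using coord[of x] coord[of y] by (simp add: PiE_iff extensional_def)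
qed (use assms in \<open>simp add: cylinder_def\<close>)

definition ball_order :: "real \<Rightarrow> nat" where
  "ball_order r = (LEAST n. (1/2) ^ n < r)"

lemma half_power_less_iff:
  assumes "0 < r"
  shows "(1/2) ^ n < r \<longleftrightarrow> ball_order r \<le> n"
proof
  assume "(1/2) ^ n < r"
  then show "ball_order r \<le> n" unfolding ball_order_def by (rule Least_le)
next
  assume "ball_order r \<le> n"
  have "\<exists>n. (1/2) ^ n < r" using real_arch_pow_inv[OF assms, of "1/2"] by simp
  then have "(1/2) ^ ball_order r < r" unfolding ball_order_def by (rule LeastI_ex)
  moreover have "(1/2::real) ^ n \<le> (1/2) ^ ball_order r"
    using \<open>ball_order r \<le> n\<close> by (intro power_decreasing) auto
  ultimately show "(1/2) ^ n < r" by linarith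
qed

lemma le_half_power_iff: "0 < r \<Longrightarrow> r \<le> (1/2) ^ n \<longleftrightarrow> n < ball_order r"
  using half_power_less_iff[of r n] by linarith

lemma ball_order_bounds:
  assumes "0 < r" "r \<le> 1"
  shows "(1/2) ^ ball_order r < r" "r \<le> 2 * (1/2) ^ ball_order r"
proof -
  show "(1/2) ^ ball_order r < r" using assms by (simp add: half_power_less_iff)
  have "0 < ball_order r" using assms le_half_power_iff[of r 0] by simp
  then obtain n where order_eq: "ball_order r = Suc n" by (cases "ball_order r") auto
  then have "r \<le> (1/2) ^ n" using assms by (simp add: le_half_power_iff)
  then show "r \<le> 2 * (1/2) ^ ball_order r" by (simp add: order_eq)
qed

lemma ball_eq_cylinder:
  assumes "0 < r"
  shows "ball x r = cylinder (coord x) (ball_order r)"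
proof -
  have "dist x y < r \<longleftrightarrow> dist x y \<le> (1/2) ^ ball_order r" for y
  proof (cases "x = y")
    case False
    then obtain k where "dist x y = (1/2) ^ k" by (auto simp: dist_cantor_def)
    then show ?thesis using assms by (simp add: half_power_less_iff power_decreasing_iff)
  qed (simp add: assms)
  then show ?thesis by (auto simp: mem_cylinder_coord_iff)
qed

definition cylinder_radius :: "nat \<Rightarrow> real" where
  "cylinder_radius n = 2 * (1/2) ^ n"

lemma cylinder_radius_pos [simp]: "0 < cylinder_radius n"
  by (simp add: cylinder_radius_def)

lemma cylinder_radius_tendsto_0: "cylinder_radius \<longlonglongrightarrow> 0"
  unfolding cylinder_radius_def[abs_def] by real_asymp

lemma ball_order_cylinder_radius: "ball_order (cylinder_radius n) = n"
proof -
  have "(1/2) ^ k < cylinder_radius n \<longleftrightarrow> n \<le> k" for k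
  proof (cases n)
    case 0
    have "(1/2::real) ^ k \<le> 1" by (rule power_le_one) auto
    then have "(1/2::real) ^ k < 2" by linarith
    then show ?thesis by (simp add: 0 cylinder_radius_def)
  next
    case (Suc m)
    then show ?thesis by (auto simp: cylinder_radius_def power_strict_decreasing_iff)
  qed
  then show ?thesis
    by (metis cylinder_radius_pos half_power_less_iff order.refl order.antisym)
qed

lemma ball_cylinder_radius: "ball x (cylinder_radius n) = cylinder (coord x) n"
  by (simp add: ball_eq_cylinder ball_order_cylinder_radius)

lemma open_cylinder: "open (cylinder \<epsilon> n)"
proof -
  obtain x where "x \<in> cylinder \<epsilon> n" using cylinder_nonempty by blast
  then have "cylinder \<epsilon> n = ball x (cylinder_radius n)"
    by (simp add: ball_cylinder_radius cylinder_eq_of_mem)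
  then show ?thesis by simp
qed

lemma borel_cylinder [measurable]: "cylinder \<epsilon> n \<in> sets borel"
  by (rule borel_open[OF open_cylinder])

lemma measurable_coord [measurable]: "(\<lambda>x. coord x j) \<in> borel \<rightarrow>\<^sub>M count_space UNIV"
proof (rule measurable_count_space_eq2_countable[THEN iffD2])
  have "(\<lambda>x. coord x j) -` {a} = (\<Union>x\<in>{x. coord x j = a}. cylinder (coord x) j)" for a
    using coord_eq_of_mem_cylinder by auto
  then have "open ((\<lambda>x. coord x j) -` {a})" for a
    by (simp add: open_UN open_cylinder)
  then show "(\<lambda>x. coord x j) \<in> space borel \<rightarrow> UNIV \<and>
      (\<forall>a\<in>UNIV. (\<lambda>x. coord x j) -` {a} \<inter> space borel \<in> sets borel)" by simp
qed

definition cylinders :: "nat \<Rightarrow> cantor set set" where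
  "cylinders n = range (\<lambda>x. cylinder (coord x) n)"

lemma cylinder_in_cylinders: "cylinder \<epsilon> n \<in> cylinders n"
proof -
  obtain x where "x \<in> cylinder \<epsilon> n" using cylinder_nonempty by blast
  then show ?thesis unfolding cylinders_def using cylinder_eq_of_mem by blast
qed

lemma bij_betw_cylinders: "bij_betw (\<lambda>\<epsilon>. cylinder \<epsilon> n) ({1..n} \<rightarrow>\<^sub>E UNIV) (cylinders n)"
proof (rule bij_betwI')
  fix \<epsilon> \<epsilon>' :: "nat \<Rightarrow> bool"
  assume words: "\<epsilon> \<in> {1..n} \<rightarrow>\<^sub>E UNIV" "\<epsilon>' \<in> {1..n} \<rightarrow>\<^sub>E UNIV"
  show "cylinder \<epsilon> n = cylinder \<epsilon>' n \<longleftrightarrow> \<epsilon> = \<epsilon>'"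
  proof
    assume same: "cylinder \<epsilon> n = cylinder \<epsilon>' n"
    obtain x where "x \<in> cylinder \<epsilon> n" using cylinder_nonempty by blast
    then have "\<epsilon> j = \<epsilon>' j" if "j \<in> {1..n}" for j
      using that same unfolding cylinder_def by blast
    then show "\<epsilon> = \<epsilon>'" by (rule PiE_ext[OF words])
  qed simp
next
  fix C assume "C \<in> cylinders n"
  then obtain x where "C = cylinder (coord x) n" by (auto simp: cylinders_def)
  then have "C = cylinder (restrict (coord x) {1..n}) n" by (simp add: cylinder_def)
  then show "\<exists>\<epsilon>\<in>{1..n} \<rightarrow>\<^sub>E UNIV. C = cylinder \<epsilon> n"
    by (intro bexI[of _ "restrict (coord x) {1..n}"]) auto
qed (rule cylinder_in_cylinders)

lemma finite_cylinders: "finite (cylinders n)"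
  using bij_betw_finite[OF bij_betw_cylinders] by (simp add: finite_PiE)

lemma countable_UN_cylinders: "countable (\<Union>n. cylinders n)"
  by (intro countable_UN countableI_type countable_finite finite_cylinders)

lemma sum_cylinders_prod:
  fixes f :: "nat \<Rightarrow> bool \<Rightarrow> 'a::comm_semiring_1"
  assumes "\<And>\<epsilon>. g (cylinder \<epsilon> n) = (\<Prod>j=1..n. f j (\<epsilon> j))"
  shows "(\<Sum>C\<in>cylinders n. g C) = (\<Prod>j=1..n. f j True + f j False)"
proof -
  have "(\<Sum>C\<in>cylinders n. g C) = (\<Sum>\<epsilon>\<in>{1..n} \<rightarrow>\<^sub>E UNIV. \<Prod>j=1..n. f j (\<epsilon> j))"
    using sum.reindex_bij_betw[OF bij_betw_cylinders, of g n] by (simp add: assms)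
  also have "\<dots> = (\<Prod>j=1..n. \<Sum>e\<in>UNIV. f j e)"
    by (rule prod_sum_PiE[symmetric]) auto
  finally show ?thesis by (simp add: UNIV_bool add.commute)
qed

lemma open_eq_Union_cylinders:
  assumes "open S"
  shows "S = \<Union>{C\<in>\<Union>n. cylinders n. C \<subseteq> S}"
proof (intro equalityI subsetI)
  fix x assume "x \<in> S"
  then obtain e where "0 < e" "ball x e \<subseteq> S" using assms open_contains_ball by blast
  then have "cylinder (coord x) (ball_order e) \<in> {C\<in>\<Union>n. cylinders n. C \<subseteq> S}"
    using cylinder_in_cylinders by (auto simp: ball_eq_cylinder)
  then show "x \<in> \<Union>{C\<in>\<Union>n. cylinders n. C \<subseteq> S}" by (rule UnionI) (rule mem_cylinder_coord)
qed auto

lemma ex_disjoint_representatives: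
  fixes D :: "'a \<Rightarrow> 'b set"
  assumes countable: "countable (D ` F)"
    and overlap: "\<And>x y. x \<in> F \<Longrightarrow> y \<in> F \<Longrightarrow> D x \<inter> D y \<noteq> {} \<Longrightarrow> D x = D y"
  obtains T where "countable T" "T \<subseteq> F" "D ` T = D ` F" "disjoint_family_on D T"
proof -
  obtain T where "T \<subseteq> F" and inj: "inj_on D T" and image: "D ` F = D ` T"
    using subset_image_inj[of "D ` F" D F] by auto
  show thesis
  proof
    show "countable T" using countable_image_inj_on[OF _ inj] countable image by simp
    have "D x \<inter> D y = {}" if "x \<in> T" "y \<in> T" "x \<noteq> y" for x y
      using overlap[of x y] that \<open>T \<subseteq> F\<close> inj by (auto dest: inj_onD)
    then show "disjoint_family_on D T" by (simp add: disjoint_family_on_def)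
  qed (use \<open>T \<subseteq> F\<close> image in auto)
qed

text \<open>Cylinders are nested or disjoint, so the largest admissible cylinders around the points of a set
  form a partition.\<close>

lemma ex_disjoint_cylinders:
  fixes F :: "cantor set"
  assumes "\<forall>x\<in>F. \<exists>n. P n (cylinder (coord x) n)"
  obtains T k where "countable T" "T \<subseteq> F" "F \<subseteq> (\<Union>x\<in>T. cylinder (coord x) (k x))"
    "disjoint_family_on (\<lambda>x. cylinder (coord x) (k x)) T"
    "\<And>x. x \<in> T \<Longrightarrow> P (k x) (cylinder (coord x) (k x))"
proof -
  define k where "k x = (LEAST n. P n (cylinder (coord x) n))" for x
  define D where "D x = cylinder (coord x) (k x)" for x
  have P_k: "P (k x) (cylinder (coord x) (k x))" if "x \<in> F" for x
    unfolding k_def using bspec[OF assms that] by (rule LeastI_ex)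
  have k_le: "k x \<le> n" if "P n (cylinder (coord x) n)" for x n
    unfolding k_def using that by (rule Least_le)
  have D_eq: "D x = D y" if "x \<in> F" "z \<in> D x" "z \<in> D y" "k x \<le> k y" for x y z
  proof -
    have same: "cylinder (coord x) (k x) = cylinder (coord y) (k x)"
      using that(2-4) cylinder_eq_of_mem_le unfolding D_def by blast
    then have "k y \<le> k x" using P_k[OF that(1)] by (intro k_le) simp
    then show ?thesis using same that(4) by (simp add: D_def)
  qed
  have "D ` F \<subseteq> (\<Union>n. cylinders n)" using cylinder_in_cylinders by (fastforce simp: D_def)
  then have "countable (D ` F)" by (rule countable_subset[OF _ countable_UN_cylinders])
  moreover have "D x = D y" if "x \<in> F" "y \<in> F" "D x \<inter> D y \<noteq> {}" for x y
  proof -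
    from that(3) obtain z where "z \<in> D x" "z \<in> D y" by blast
    then show ?thesis
      using D_eq[of x z y] D_eq[of y z x] that(1,2) nat_le_linear[of "k x" "k y"] by auto
  qed
  ultimately obtain T
    where T: "countable T" "T \<subseteq> F" "disjoint_family_on D T" and image: "D ` T = D ` F"
    by (rule ex_disjoint_representatives)
  have "F \<subseteq> (\<Union>x\<in>T. D x)" using image by (auto simp: D_def)
  then show thesis using that[of T k] T P_k unfolding D_def by blast
qed

section \<open>Density theorems\<close>

lemma measure_cball_le_of_cylinders:
  assumes finite_N: "finite_measure N" and sets_N: "sets N = sets borel" and s_pos: "0 < s"
    and bound: "\<And>n. m \<le> n \<Longrightarrow> measure N (cylinder (coord x) n) \<le> ((1/2) ^ n) powr s"
    and "0 < r" "r \<le> (1/2) ^ m"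
  shows "measure N (cball x r) \<le> 2 powr s * r powr s"
proof -
  interpret finite_measure N by (rule finite_N)
  have "m < ball_order r" using assms by (simp add: le_half_power_iff)
  then obtain n where order_eq: "ball_order r = Suc n" and "m \<le> n" by (cases "ball_order r") auto
  have "r \<le> (1/2) ^ n" using \<open>0 < r\<close> order_eq by (simp add: le_half_power_iff)
  then have "cball x r \<subseteq> cylinder (coord x) n" by (auto simp: mem_cylinder_coord_iff)
  then have "measure N (cball x r) \<le> measure N (cylinder (coord x) n)"
    by (rule finite_measure_mono) (simp add: sets_N borel_cylinder)
  also have "\<dots> \<le> ((1/2) ^ n) powr s" by (rule bound[OF \<open>m \<le> n\<close>])
  also have "\<dots> \<le> (2 * r) powr s"
    using half_power_less_iff[OF \<open>0 < r\<close>, of "Suc n"] order_eq s_pos by (intro powr_mono2) auto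
  finally show ?thesis using \<open>0 < r\<close> by (simp add: powr_mult)
qed

lemma hausdorff_measure_neq_0_of_density:
  fixes N :: "cantor measure"
  assumes prob_N: "prob_space N" and sets_N: "sets N = sets borel" and s_pos: "0 < s"
    and dense: "AE x in N. x \<in> E \<and>
      (\<forall>\<^sub>F n in sequentially. measure N (cylinder (coord x) n) \<le> ((1/2) ^ n) powr s)"
  shows "hausdorff_measure s E \<noteq> 0"
proof
  assume zero: "hausdorff_measure s E = 0"
  interpret prob_space N by (rule prob_N)
  have space: "space N = UNIV" using sets_eq_imp_space_eq[OF sets_N] by simp
  define A where "A m = {x\<in>E. \<forall>n\<ge>m. measure N (cylinder (coord x) n) \<le> ((1/2) ^ n) powr s}" for m
  have "outer_measure_of N (A m) = 0" for m
  proof -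
    have "outer_measure_of N (A m) \<le> ennreal (2 powr s) * hausdorff_measure s (A m)"
    proof (rule outer_measure_of_le_hausdorff_measure[OF finite_measure_axioms sets_N s_pos])
      show "measure N (cball x r) \<le> 2 powr s * r powr s"
        if "x \<in> A m" "0 < r" "r \<le> (1/2) ^ m" for x r
        using that
        by (intro measure_cball_le_of_cylinders[OF finite_measure_axioms sets_N s_pos]) (auto simp: A_def)
    qed auto
    also have "\<dots> \<le> ennreal (2 powr s) * hausdorff_measure s E"
      by (intro mult_left_mono hausdorff_measure_subset) (auto simp: A_def)
    finally show ?thesis by (simp add: zero)
  qed
  then have "outer_measure_of N (\<Union>m. A m) \<le> 0"
    using outer_measure_of_UN[of A N] by (simp add: space)
  moreover have "AE x in N. x \<in> (\<Union>m. A m)"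
    using dense by eventually_elim (auto simp: A_def eventually_sequentially)
  ultimately show False
    using emeasure_space_le_outer_measure_of[of "\<Union>m. A m" N] by (simp add: emeasure_space_1)
qed

lemma delta_packing_cylinder_balls:
  assumes "T \<subseteq> F" "disjoint_family_on (\<lambda>x. cylinder (coord x) (k x)) T"
    and "\<And>x. x \<in> T \<Longrightarrow> cylinder_radius (k x) \<le> \<delta>"
  shows "delta_packing \<delta> F ((\<lambda>x. (x, cylinder_radius (k x))) ` T)"
  unfolding delta_packing_def
proof
  show "\<forall>(x, r)\<in>(\<lambda>x. (x, cylinder_radius (k x))) ` T. x \<in> F \<and> 0 < r \<and> r \<le> \<delta>"
    using assms(1,3) by auto
  show "disjoint_family_on (\<lambda>(x, r). ball x r) ((\<lambda>x. (x, cylinder_radius (k x))) ` T)"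
    using assms(2) unfolding disjoint_family_on_def by (auto simp: ball_cylinder_radius)
qed

lemma outer_measure_of_le_mf_packing_pre_delta:
  fixes N :: "cantor measure"
  assumes finite_N: "finite_measure N" and sets_N: "sets N = sets borel" and c_pos: "0 < c"
    and \<delta>_pos: "0 < \<delta>"
    and dense: "\<And>x. x \<in> F \<Longrightarrow>
      \<exists>\<^sub>F n in sequentially.
        measure N (cylinder (coord x) n) \<le> c * mf_gauge \<mu> q t x (cylinder_radius n)"
  shows "outer_measure_of N F \<le> ennreal c * mf_packing_pre_delta \<mu> q t \<delta> F"
proof -
  interpret finite_measure N by (rule finite_N)
  define P where "P n C \<longleftrightarrow> cylinder_radius n \<le> \<delta>
    \<and> measure N C \<le> c * (cylinder_radius n powr t * measure \<mu> C powr q)" for n C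
  have "\<forall>x\<in>F. \<exists>n. P n (cylinder (coord x) n)"
  proof
    fix x assume "x \<in> F"
    have "\<forall>\<^sub>F n in sequentially. cylinder_radius n < \<delta>"
      using cylinder_radius_tendsto_0 \<delta>_pos by (rule order_tendstoD)
    then show "\<exists>n. P n (cylinder (coord x) n)"
      using frequently_ex[OF frequently_eventually_frequently[OF dense[OF \<open>x \<in> F\<close>]]]
      by (auto simp: P_def mf_gauge_def ball_cylinder_radius intro: less_imp_le)
  qed
  then obtain T k where T_cover: "countable T" "T \<subseteq> F" "F \<subseteq> (\<Union>x\<in>T. cylinder (coord x) (k x))"
      and disjoint: "disjoint_family_on (\<lambda>x. cylinder (coord x) (k x)) T"
      and P_k: "\<And>x. x \<in> T \<Longrightarrow> P (k x) (cylinder (coord x) (k x))"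
    by (rule ex_disjoint_cylinders) (rule that)
  define \<B> where "\<B> = (\<lambda>x. (x, cylinder_radius (k x))) ` T"
  have "delta_packing \<delta> F \<B>"
    unfolding \<B>_def using T_cover(2) disjoint P_k
    by (intro delta_packing_cylinder_balls) (auto simp: P_def)
  have "outer_measure_of N F \<le> (\<Sum>\<^sub>\<infinity>x\<in>T. outer_measure_of N (cylinder (coord x) (k x)))"
    using sets_eq_imp_space_eq[OF sets_N] by (intro outer_measure_of_le_infsum T_cover) simp
  also have "\<dots> \<le> (\<Sum>\<^sub>\<infinity>x\<in>T. ennreal c * ennreal (mf_gauge \<mu> q t x (cylinder_radius (k x))))"
    using P_k c_pos by (intro infsum_mono_ennreal)
      (auto simp: sets_N P_def borel_cylinder emeasure_eq_measure mf_gauge_def ball_cylinder_radius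
        simp flip: ennreal_mult intro!: ennreal_leI)
  also have "\<dots> \<le> ennreal c * mf_sum \<mu> q t \<B>"
    unfolding \<B>_def mf_sum_image by (rule infsum_cmult_le_ennreal)
  also have "\<dots> \<le> ennreal c * mf_packing_pre_delta \<mu> q t \<delta> F"
    unfolding mf_packing_pre_delta_def using \<open>delta_packing \<delta> F \<B>\<close>
    by (intro mult_left_mono SUP_upper) auto
  finally show ?thesis .
qed

lemma mf_packing_neq_0_of_density:
  fixes N :: "cantor measure"
  assumes prob_N: "prob_space N" and sets_N: "sets N = sets borel" and c_pos: "0 < c"
    and dense: "AE x in N. x \<in> E \<and>
      (\<exists>\<^sub>F n in sequentially.
        measure N (cylinder (coord x) n) \<le> c * mf_gauge \<mu> q t x (cylinder_radius n))"
  shows "mf_packing \<mu> q t E \<noteq> 0"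
proof
  assume zero: "mf_packing \<mu> q t E = 0"
  interpret prob_space N by (rule prob_N)
  define A where "A = {x\<in>E. \<exists>\<^sub>F n in sequentially.
    measure N (cylinder (coord x) n) \<le> c * mf_gauge \<mu> q t x (cylinder_radius n)}"
  have "1 \<le> outer_measure_of N A"
    using emeasure_space_le_outer_measure_of[of A N] dense by (simp add: A_def emeasure_space_1)
  also have "outer_measure_of N A \<le> ennreal c * mf_packing \<mu> q t A"
    unfolding mf_packing_eq_cover_measure
  proof (rule outer_measure_of_le_cover_measure[OF _ c_pos])
    show "A \<subseteq> space N" using sets_eq_imp_space_eq[OF sets_N] by simp
    fix U :: "cantor set"
    have "outer_measure_of N (U \<inter> A) \<le> ennreal c * mf_packing_pre \<mu> q t (U \<inter> A)"
      unfolding mf_packing_pre_eq_INF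
      by (intro le_cmult_INF_ennreal[OF c_pos]
          outer_measure_of_le_mf_packing_pre_delta[OF _ sets_N c_pos])
         (auto simp: A_def finite_measure_axioms)
    also have "\<dots> \<le> ennreal c * mf_packing_pre \<mu> q t U"
      by (intro mult_left_mono mf_packing_pre_subset) auto
    finally show "outer_measure_of N (U \<inter> A) \<le> ennreal c * mf_packing_pre \<mu> q t U" .
  qed
  also have "ennreal c * mf_packing \<mu> q t A \<le> ennreal c * mf_packing \<mu> q t E"
    unfolding mf_packing_eq_cover_measure
    by (intro mult_left_mono cover_measure_subset) (auto simp: A_def)
  finally show False by (simp add: zero)
qed

section \<open>Partition sums\<close>

definition partition_sum :: "cantor measure \<Rightarrow> real \<Rightarrow> nat \<Rightarrow> real" where
  "partition_sum \<mu> q n = (\<Sum>C\<in>cylinders n. measure \<mu> C powr q)"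

lemma mf_hausdorff_pre_delta_le_partition_sum:
  assumes "cylinder_radius n \<le> \<delta>"
  shows "mf_hausdorff_pre_delta \<mu> q t \<delta> F \<le> ennreal (cylinder_radius n powr t * partition_sum \<mu> q n)"
proof -
  define f where "f C = ennreal (cylinder_radius n powr t * measure \<mu> C powr q)" for C
  obtain T k where T_cover: "T \<subseteq> F" "F \<subseteq> (\<Union>x\<in>T. cylinder (coord x) (k x))"
      and disjoint: "disjoint_family_on (\<lambda>x. cylinder (coord x) (k x)) T"
      and k_eq: "\<And>x. x \<in> T \<Longrightarrow> k x = n"
    by (rule ex_disjoint_cylinders[of F "\<lambda>m _. m = n"]) (auto intro: that)
  have inj: "inj_on (\<lambda>x. cylinder (coord x) n) T"
  proof (rule inj_onI, rule ccontr)
    fix x y assume "x \<in> T" "y \<in> T" "cylinder (coord x) n = cylinder (coord y) n" "x \<noteq> y"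
    then show False
      using disjoint_family_onD[OF disjoint, of x y] k_eq cylinder_nonempty[of "coord x" n] by simp
  qed
  have image_subset: "(\<lambda>x. cylinder (coord x) n) ` T \<subseteq> cylinders n"
    by (auto simp: cylinder_in_cylinders)
  have "centered_cover \<delta> F ((\<lambda>x. (x, cylinder_radius n)) ` T)"
    using T_cover k_eq assms by (auto simp: centered_cover_def ball_cylinder_radius)
  then have "mf_hausdorff_pre_delta \<mu> q t \<delta> F \<le> mf_sum \<mu> q t ((\<lambda>x. (x, cylinder_radius n)) ` T)"
    unfolding mf_hausdorff_pre_delta_def by (intro INF_lower) simp
  also have "\<dots> = (\<Sum>\<^sub>\<infinity>C\<in>(\<lambda>x. cylinder (coord x) n) ` T. f C)"
    unfolding infsum_reindex[OF inj] mf_sum_image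
    by (simp add: comp_def f_def mf_gauge_def ball_cylinder_radius)
  also have "\<dots> = sum f ((\<lambda>x. cylinder (coord x) n) ` T)"
    by (rule infsum_finite[OF finite_subset[OF image_subset finite_cylinders]])
  also have "\<dots> \<le> sum f (cylinders n)"
    using image_subset by (intro sum_mono2 finite_cylinders) auto
  also have "\<dots> = ennreal (cylinder_radius n powr t * partition_sum \<mu> q n)"
    by (simp add: f_def partition_sum_def sum_distrib_left)
  finally show ?thesis .
qed

lemma mf_hausdorff_eq_0_of_partition_sum:
  assumes "a < t" and sums_le: "\<exists>\<^sub>F n in sequentially. partition_sum \<mu> q n \<le> 2 powr (a * real n)"
  shows "mf_hausdorff \<mu> q t E = 0"
proof -
  define \<rho> where "\<rho> = 2 powr (a - t)"
  have "0 \<le> \<rho>" "\<rho> < 1" using assms(1) powr_less_mono[of "a - t" 0 2] by (auto simp: \<rho>_def)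
  then have "(\<lambda>n. 2 powr t * \<rho> ^ n) \<longlonglongrightarrow> 2 powr t * 0" by (intro tendsto_intros) auto
  then have lim_0: "(\<lambda>n. ennreal (2 powr t * \<rho> ^ n)) \<longlonglongrightarrow> ennreal 0" by (intro tendsto_ennrealI) simp
  have "mf_hausdorff_pre_delta \<mu> q t \<delta> F \<le> ennreal 0" if "0 < \<delta>" for \<delta> F
  proof (rule tendsto_lowerbound_frequently[OF lim_0])
    have "\<forall>\<^sub>F n in sequentially. cylinder_radius n < \<delta>"
      using cylinder_radius_tendsto_0 that by (rule order_tendstoD)
    with sums_le have "\<exists>\<^sub>F n in sequentially.
        partition_sum \<mu> q n \<le> 2 powr (a * real n) \<and> cylinder_radius n < \<delta>"
      by (rule frequently_eventually_frequently)
    then show "\<exists>\<^sub>F n in sequentially. mf_hausdorff_pre_delta \<mu> q t \<delta> F \<le> ennreal (2 powr t * \<rho> ^ n)"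
    proof (rule frequently_elim1)
      fix n assume n_le: "partition_sum \<mu> q n \<le> 2 powr (a * real n) \<and> cylinder_radius n < \<delta>"
      have "cylinder_radius n powr t * partition_sum \<mu> q n
          \<le> cylinder_radius n powr t * 2 powr (a * real n)"
        using n_le by (intro mult_left_mono) auto
      also have "\<dots> = 2 powr t * \<rho> ^ n"
        by (simp add: cylinder_radius_def powr_mult \<rho>_def half_power_powr_mult[symmetric])
      finally show "mf_hausdorff_pre_delta \<mu> q t \<delta> F \<le> ennreal (2 powr t * \<rho> ^ n)"
        using n_le
        by (intro order.trans[OF mf_hausdorff_pre_delta_le_partition_sum ennreal_leI]) auto
    qed
  qed
  then have "mf_hausdorff_pre \<mu> q t F \<le> 0" for F
    unfolding mf_hausdorff_pre_eq_SUP by (intro SUP_least) auto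
  then have "mf_hausdorff \<mu> q t E \<le> 0"
    unfolding mf_hausdorff_def by (intro SUP_least) auto
  then show ?thesis by simp
qed

theorem mf_b_le:
  assumes "\<exists>\<^sub>F n in sequentially. partition_sum \<mu> q n \<le> 2 powr (a * real n)"
  shows "mf_b \<mu> E q \<le> ereal a"
  unfolding mf_b_def
  by (rule Inf_ereal_Collect_le, rule mf_hausdorff_eq_0_of_partition_sum[OF _ assms])

lemma powr_le_ball_order:
  assumes "0 < r" "r \<le> 1"
  shows "r powr t \<le> max 1 (2 powr t) * ((1/2) ^ ball_order r) powr t"
proof (cases "t \<ge> 0")
  case True
  then have "r powr t \<le> (2 * (1/2) ^ ball_order r) powr t"
    using assms ball_order_bounds[OF assms] by (intro powr_mono2) auto
  also have "\<dots> = 2 powr t * ((1/2) ^ ball_order r) powr t" by (simp add: powr_mult)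
  also have "\<dots> \<le> max 1 (2 powr t) * ((1/2) ^ ball_order r) powr t" by (intro mult_right_mono) auto
  finally show ?thesis .
next
  case False
  then have "r powr t \<le> 1 * ((1/2) ^ ball_order r) powr t"
    using ball_order_bounds[OF assms] by (simp add: powr_mono2')
  also have "\<dots> \<le> max 1 (2 powr t) * ((1/2) ^ ball_order r) powr t" by (intro mult_right_mono) auto
  finally show ?thesis .
qed

lemma mf_gauge_le_ball_order:
  assumes "0 < r" "r \<le> 1"
  shows "mf_gauge \<mu> q t x r
    \<le> max 1 (2 powr t) * (((1/2) ^ ball_order r) powr t * measure \<mu> (ball x r) powr q)"
  unfolding mf_gauge_def mult.assoc[symmetric]
  by (rule mult_right_mono[OF powr_le_ball_order[OF assms]]) simp

lemma inj_on_packing_balls: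
  fixes \<B> :: "('a::metric_space \<times> real) set"
  assumes "delta_packing \<delta> E \<B>"
  shows "inj_on (\<lambda>(x, r). ball x r) \<B>"
proof (rule inj_onI, rule ccontr)
  fix b b' assume mem: "b \<in> \<B>" "b' \<in> \<B>" "b \<noteq> b'"
    and same: "(case b of (x, r) \<Rightarrow> ball x r) = (case b' of (x, r) \<Rightarrow> ball x r)"
  have "disjoint_family_on (\<lambda>(x, r). ball x r) \<B>" using assms by (simp add: delta_packing_def)
  from disjoint_family_onD[OF this mem] have "(case b of (x, r) \<Rightarrow> ball x r) = {}" using same by simp
  moreover have "0 < snd b" using assms mem(1) by (auto simp: delta_packing_def)
  ultimately show False by (cases b) auto
qed

lemma sum_mf_gauge_packing_le:
  assumes finite: "finite G" and packing: "delta_packing ((1/2) ^ M) E G"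
  obtains L where "(\<Sum>(x, r)\<in>G. mf_gauge \<mu> q t x r)
    \<le> (\<Sum>n=M..L. max 1 (2 powr t) * (((1/2) ^ n) powr t * partition_sum \<mu> q n))"
proof
  define L where "L = Max ((\<lambda>b. ball_order (snd b)) ` G)"
  define cyl where "cyl b = (ball_order (snd b), ball (fst b) (snd b))" for b :: "cantor \<times> real"
  define g where "g = (\<lambda>(n, C). max 1 (2 powr t) * (((1/2) ^ n) powr t * measure \<mu> C powr q))"
  have radius: "0 < snd b" "snd b \<le> (1/2) ^ M" "snd b \<le> 1" if "b \<in> G" for b
  proof -
    show "0 < snd b" using packing that by (auto simp: delta_packing_def)
    show "snd b \<le> (1/2) ^ M" using packing that by (auto simp: delta_packing_def)
    also have "\<dots> \<le> 1" by (rule power_le_one) auto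
    finally show "snd b \<le> 1" .
  qed
  have "inj_on cyl G"
    using inj_on_packing_balls[OF packing] by (auto simp: inj_on_def cyl_def split_beta)
  have "(\<Sum>(x, r)\<in>G. mf_gauge \<mu> q t x r) \<le> (\<Sum>b\<in>G. g (cyl b))"
    using radius by (intro sum_mono) (simp add: g_def cyl_def split_beta mf_gauge_le_ball_order)
  also have "\<dots> = sum g (cyl ` G)"
    by (simp add: sum.reindex[OF \<open>inj_on cyl G\<close>])
  also have "\<dots> \<le> sum g (SIGMA n:{M..L}. cylinders n)"
  proof (rule sum_mono2)
    show "cyl ` G \<subseteq> (SIGMA n:{M..L}. cylinders n)"
    proof (rule image_subsetI)
      fix b assume "b \<in> G"
      have "M \<le> ball_order (snd b)" using radius[OF \<open>b \<in> G\<close>] le_half_power_iff[of "snd b" M] by simp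
      moreover have "ball_order (snd b) \<le> L" using finite \<open>b \<in> G\<close> by (simp add: L_def)
      ultimately show "cyl b \<in> (SIGMA n:{M..L}. cylinders n)"
        using radius(1)[OF \<open>b \<in> G\<close>] by (simp add: cyl_def ball_eq_cylinder cylinder_in_cylinders)
    qed
  qed (auto simp: g_def finite_cylinders)
  also have "\<dots> = (\<Sum>n=M..L. \<Sum>C\<in>cylinders n. g (n, C))"
    by (simp add: sum.Sigma finite_cylinders)
  also have "\<dots> = (\<Sum>n=M..L. max 1 (2 powr t) * (((1/2) ^ n) powr t * partition_sum \<mu> q n))"
    by (simp add: g_def partition_sum_def sum_distrib_left)
  finally show "(\<Sum>(x, r)\<in>G. mf_gauge \<mu> q t x r)
    \<le> (\<Sum>n=M..L. max 1 (2 powr t) * (((1/2) ^ n) powr t * partition_sum \<mu> q n))" .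
qed

lemma mf_packing_pre_delta_le_geometric:
  assumes "a < t" and sums_le: "\<And>n. M \<le> n \<Longrightarrow> partition_sum \<mu> q n \<le> 2 powr (a * real n)"
  defines "\<rho> \<equiv> 2 powr (a - t)"
  shows "mf_packing_pre_delta \<mu> q t ((1/2) ^ M) E \<le> ennreal (max 1 (2 powr t) * (\<rho> ^ M / (1 - \<rho>)))"
  unfolding mf_packing_pre_delta_def mf_sum_eq_infsum_mf_gauge
proof (intro SUP_least infsum_le_finite_sums)
  fix \<B> G assume "\<B> \<in> {\<B>. delta_packing ((1/2) ^ M) E \<B>}" and "finite G" "G \<subseteq> \<B>"
  then have "delta_packing ((1/2) ^ M) E G"
    using disjoint_family_on_mono[OF \<open>G \<subseteq> \<B>\<close>] by (auto simp: delta_packing_def)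
  then obtain L where "(\<Sum>(x, r)\<in>G. mf_gauge \<mu> q t x r)
      \<le> (\<Sum>n=M..L. max 1 (2 powr t) * (((1/2) ^ n) powr t * partition_sum \<mu> q n))"
    using sum_mf_gauge_packing_le[OF \<open>finite G\<close>] by blast
  also have "\<dots> \<le> (\<Sum>n=M..L. max 1 (2 powr t) * (((1/2) ^ n) powr t * 2 powr (a * real n)))"
    using sums_le by (intro sum_mono mult_left_mono) auto
  also have "\<dots> = max 1 (2 powr t) * (\<Sum>n=M..L. \<rho> ^ n)"
    by (simp add: half_power_powr_mult \<rho>_def sum_distrib_left)
  also have "\<dots> \<le> max 1 (2 powr t) * (\<rho> ^ M / (1 - \<rho>))"
    using assms(1) powr_less_mono[of "a - t" 0 2]
    by (intro mult_left_mono sum_power_atLeastAtMost_le) (auto simp: \<rho>_def)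
  finally show "(\<Sum>(x, r)\<in>G. ennreal (mf_gauge \<mu> q t x r))
      \<le> ennreal (max 1 (2 powr t) * (\<rho> ^ M / (1 - \<rho>)))"
    by (simp add: split_beta ennreal_leI)
qed simp

lemma mf_packing_eq_0_of_partition_sum:
  assumes "a < t" and sums_le: "\<forall>\<^sub>F n in sequentially. partition_sum \<mu> q n \<le> 2 powr (a * real n)"
  shows "mf_packing \<mu> q t E = 0"
proof -
  define \<rho> where "\<rho> = 2 powr (a - t)"
  have "0 \<le> \<rho>" "\<rho> < 1" using assms(1) powr_less_mono[of "a - t" 0 2] by (auto simp: \<rho>_def)
  then have "(\<lambda>M. max 1 (2 powr t) * (\<rho> ^ M / (1 - \<rho>))) \<longlonglongrightarrow> max 1 (2 powr t) * (0 / (1 - \<rho>))"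
    by (intro tendsto_intros) auto
  then have lim_0: "(\<lambda>M. ennreal (max 1 (2 powr t) * (\<rho> ^ M / (1 - \<rho>)))) \<longlonglongrightarrow> ennreal 0"
    by (intro tendsto_ennrealI) simp
  obtain M\<^sub>0 where M\<^sub>0_le: "\<And>n. M\<^sub>0 \<le> n \<Longrightarrow> partition_sum \<mu> q n \<le> 2 powr (a * real n)"
    using sums_le unfolding eventually_sequentially by blast
  have "mf_packing_pre \<mu> q t E \<le> ennreal (max 1 (2 powr t) * (\<rho> ^ M / (1 - \<rho>)))" if "M\<^sub>0 \<le> M" for M
  proof -
    have "mf_packing_pre \<mu> q t E \<le> mf_packing_pre_delta \<mu> q t ((1/2) ^ M) E"
      unfolding mf_packing_pre_eq_INF by (rule INF_lower) simp
    also have "\<dots> \<le> ennreal (max 1 (2 powr t) * (\<rho> ^ M / (1 - \<rho>)))"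
      unfolding \<rho>_def using that M\<^sub>0_le
      by (intro mf_packing_pre_delta_le_geometric[OF assms(1)]) auto
    finally show ?thesis .
  qed
  then have "mf_packing_pre \<mu> q t E \<le> ennreal 0" by (intro LIMSEQ_le_const[OF lim_0]) blast
  then show ?thesis by (intro mf_packing_eq_0I) simp
qed

theorem mf_B_le:
  assumes "\<forall>\<^sub>F n in sequentially. partition_sum \<mu> q n \<le> 2 powr (a * real n)"
  shows "mf_B \<mu> E q \<le> ereal a"
  unfolding mf_B_def
  by (rule Inf_ereal_Collect_le, rule mf_packing_eq_0_of_partition_sum[OF _ assms])

section \<open>Level sets along cylinders\<close>

lemma ball_order_log_bounds:
  assumes "0 < r" "r \<le> 1"
  shows "- log 2 r < real (ball_order r)" "real (ball_order r) \<le> 1 - log 2 r"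
proof -
  have log_half_power: "log 2 ((1/2) ^ n) = - real n" for n by (simp add: log_nat_power log_divide)
  have "log 2 ((1/2) ^ ball_order r) < log 2 r"
    using ball_order_bounds(1)[OF assms] assms(1) by simp
  then show "- log 2 r < real (ball_order r)" unfolding log_half_power by simp
  have "log 2 r \<le> log 2 (2 * (1/2) ^ ball_order r)"
    using ball_order_bounds(2)[OF assms] assms(1) by simp
  also have "\<dots> = 1 - real (ball_order r)" using log_half_power by (simp add: log_mult)
  finally show "real (ball_order r) \<le> 1 - log 2 r" by simp
qed

lemma filterlim_ball_order: "filterlim ball_order at_top (at_right 0)"
  unfolding filterlim_at_top
proof
  fix n
  show "\<forall>\<^sub>F r in at_right 0. n \<le> ball_order r"
    using eventually_at_right_real[of 0 "(1/2) ^ n"]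
  proof (rule eventually_mono)
    show "n \<le> ball_order r" if "r \<in> {0<..<(1/2) ^ n}" for r
      using that le_half_power_iff[of r n] by simp
  qed simp
qed

lemma tendsto_ball_order_div_log: "((\<lambda>r. real (ball_order r) / (- log 2 r)) \<longlongrightarrow> 1) (at_right 0)"
proof (rule tendsto_sandwich)
  have near_0: "\<forall>\<^sub>F r::real in at_right 0. r \<in> {0<..<1}" by (rule eventually_at_right_real) simp
  show "\<forall>\<^sub>F r in at_right 0. 1 \<le> real (ball_order r) / (- log 2 r)"
    using near_0
  proof eventually_elim
    case (elim r)
    then show ?case using ball_order_log_bounds(1)[of r] by (subst pos_le_divide_eq) auto
  qed
  show "\<forall>\<^sub>F r in at_right 0. real (ball_order r) / (- log 2 r) \<le> (1 - log 2 r) / (- log 2 r)"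
    using near_0
  proof eventually_elim
    case (elim r)
    then show ?case using ball_order_log_bounds(2)[of r] by (intro divide_right_mono) auto
  qed
  show "((\<lambda>r::real. (1 - log 2 r) / (- log 2 r)) \<longlongrightarrow> 1) (at_right 0)" by real_asymp
qed (rule tendsto_const)

lemma level_setI:
  assumes "(\<lambda>n. - log 2 (measure \<mu> (cylinder (coord x) n)) / real n) \<longlonglongrightarrow> \<alpha>"
  shows "x \<in> level_set \<mu> \<alpha>"
proof -
  define a where "a n = - log 2 (measure \<mu> (cylinder (coord x) n))" for n
  have "((\<lambda>r. a (ball_order r) / real (ball_order r)) \<longlongrightarrow> \<alpha>) (at_right 0)"
    using filterlim_compose[OF assms filterlim_ball_order] by (simp add: a_def)
  then have "((\<lambda>r. a (ball_order r) / real (ball_order r) * (real (ball_order r) / (- log 2 r))) \<longlongrightarrow> \<alpha> * 1)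
      (at_right 0)"
    using tendsto_ball_order_div_log by (rule tendsto_mult)
  moreover have "\<forall>\<^sub>F r in at_right 0. a (ball_order r) / real (ball_order r) *
      (real (ball_order r) / (- log 2 r)) = ln (measure \<mu> (ball x r)) / ln r"
    using eventually_at_right_real[of 0 1, simplified]
  proof eventually_elim
    case (elim r)
    then have "0 < ball_order r" using le_half_power_iff[of r 0] by simp
    with elim show ?case by (simp add: a_def ball_eq_cylinder log_def field_simps)
  qed
  ultimately have "((\<lambda>r. ln (measure \<mu> (ball x r)) / ln r) \<longlongrightarrow> \<alpha>) (at_right 0)"
    using Lim_transform_eventually by fastforce
  then show ?thesis by (simp add: level_set_def)
qed

section \<open>The strong law for bounded variables\<close>

lemma (in prob_space) prob_abs_sum_deviation_ge_le:
  fixes X :: "'i \<Rightarrow> 'a \<Rightarrow> real"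
  assumes finite: "finite I" and indep: "indep_vars (\<lambda>_. borel) X I"
    and bound: "\<And>i x. i \<in> I \<Longrightarrow> x \<in> space M \<Longrightarrow> \<bar>X i x\<bar> \<le> K"
    and K_pos: "0 < K" and e_nonneg: "0 \<le> e"
  shows "prob {x\<in>space M. e * real (card I) \<le> \<bar>\<Sum>i\<in>I. X i x - expectation (X i)\<bar>}
    \<le> 2 * exp (- (e\<^sup>2 / (2 * K\<^sup>2))) ^ card I"
proof (cases "I = {}")
  case True
  then show ?thesis by (intro order.trans[OF prob_le_1]) simp
next
  case False
  then have card_pos: "0 < real (card I)" using finite by (simp add: card_gt_0_iff)
  interpret H: Hoeffding_ineq M I X "\<lambda>_. - K" "\<lambda>_. K" "\<Sum>i\<in>I. expectation (X i)"
  proof unfold_locales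
    show "AE x in M. X i x \<in> {- K..K}" if "i \<in> I" for i
      using AE_space by eventually_elim (use bound[OF that] in \<open>simp add: abs_le_iff minus_le_iff\<close>)
  qed (use finite indep in auto)
  have "prob {x\<in>space M. e * real (card I) \<le> \<bar>\<Sum>i\<in>I. X i x - expectation (X i)\<bar>}
      = prob {x\<in>space M. \<bar>(\<Sum>i\<in>I. X i x) - (\<Sum>i\<in>I. expectation (X i))\<bar> \<ge> e * real (card I)}"
    by (simp add: sum_subtractf)
  also have "\<dots> \<le> 2 * exp (- 2 * (e * real (card I))\<^sup>2 / (\<Sum>i\<in>I. (K - (- K))\<^sup>2))"
    using e_nonneg K_pos card_pos by (intro H.Hoeffding_ineq_abs_ge) auto
  also have "- 2 * (e * real (card I))\<^sup>2 / (\<Sum>i\<in>I. (K - (- K))\<^sup>2)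
      = real (card I) * (- (e\<^sup>2 / (2 * K\<^sup>2)))"
    using K_pos card_pos by (simp add: field_simps power2_eq_square)
  also have "exp \<dots> = exp (- (e\<^sup>2 / (2 * K\<^sup>2))) ^ card I" by (rule exp_of_nat_mult)
  finally show ?thesis .
qed

lemma (in prob_space) AE_eventually_abs_sum_deviation_less:
  fixes X :: "nat \<Rightarrow> 'a \<Rightarrow> real"
  assumes indep: "indep_vars (\<lambda>_. borel) X {1..}"
    and bound: "\<And>j x. x \<in> space M \<Longrightarrow> \<bar>X j x\<bar> \<le> K"
    and K_pos: "0 < K" and e_pos: "0 < e"
  shows "AE x in M. \<forall>\<^sub>F n in sequentially. \<bar>\<Sum>j=1..n. X j x - expectation (X j)\<bar> < e * real n"
proof -
  define D where "D n x = (\<Sum>j=1..n. X j x - expectation (X j))" for n x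
  have "random_variable borel (X j)" if "j \<in> {1..n}" for j n
    using indep that by (auto simp: indep_vars_def)
  then have [measurable]: "random_variable borel (D n)" for n
    unfolding D_def by (intro borel_measurable_sum borel_measurable_diff borel_measurable_const)
  have tail_le: "prob {x\<in>space M. e * real n \<le> \<bar>D n x\<bar>} \<le> 2 * exp (- (e\<^sup>2 / (2 * K\<^sup>2))) ^ n" for n
  proof -
    have "indep_vars (\<lambda>_. borel) X {1..n}" by (rule indep_vars_subset[OF indep]) auto
    from prob_abs_sum_deviation_ge_le[OF _ this bound K_pos less_imp_le[OF e_pos]]
    show ?thesis by (simp add: D_def)
  qed
  have "summable (\<lambda>n. 2 * exp (- (e\<^sup>2 / (2 * K\<^sup>2))) ^ n)"
    using e_pos K_pos by (intro summable_mult summable_geometric) auto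
  then have "summable (\<lambda>n. prob {x\<in>space M. e * real n \<le> \<bar>D n x\<bar>})"
    by (rule summable_comparison_test'[of _ 0]) (simp add: tail_le)
  then have "AE x in M. \<forall>\<^sub>F n in sequentially. x \<in> space M - {x\<in>space M. e * real n \<le> \<bar>D n x\<bar>}"
    by (intro borel_cantelli_AE1) (auto simp: emeasure_eq_measure)
  then show ?thesis
    unfolding D_def by eventually_elim (auto elim: eventually_mono)
qed

theorem (in prob_space) strong_law_bounded:
  fixes X :: "nat \<Rightarrow> 'a \<Rightarrow> real"
  assumes indep: "indep_vars (\<lambda>_. borel) X {1..}"
    and bound: "\<And>j x. x \<in> space M \<Longrightarrow> \<bar>X j x\<bar> \<le> K"
  shows "AE x in M. (\<lambda>n. (\<Sum>j=1..n. X j x - expectation (X j)) / real n) \<longlonglongrightarrow> 0"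
proof -
  define D where "D n x = (\<Sum>j=1..n. X j x - expectation (X j))" for n x
  have bound': "\<bar>X j x\<bar> \<le> \<bar>K\<bar> + 1" if "x \<in> space M" for j x using bound[OF that, of j] by simp
  have "AE x in M. \<forall>k. \<forall>\<^sub>F n in sequentially. \<bar>D n x\<bar> < inverse (real (Suc k)) * real n"
    unfolding AE_all_countable D_def
    by (intro allI AE_eventually_abs_sum_deviation_less[OF indep bound']) auto
  then have "AE x in M. (\<lambda>n. D n x / real n) \<longlonglongrightarrow> 0"
  proof eventually_elim
    case (elim x)
    show ?case
    proof (rule tendstoI)
      fix e :: real assume "0 < e"
      then obtain k where k_less: "inverse (real (Suc k)) < e" using reals_Archimedean by blast
      have "\<forall>\<^sub>F n in sequentially. \<bar>D n x\<bar> < inverse (real (Suc k)) * real n" using elim by blast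
      then show "\<forall>\<^sub>F n in sequentially. dist (D n x / real n) 0 < e"
        using eventually_gt_at_top[of 0]
      proof eventually_elim
        case (elim n)
        then have "\<bar>D n x\<bar> / real n < inverse (real (Suc k))" by (simp add: pos_divide_less_eq)
        then show ?case using k_less by simp
      qed
    qed
  qed
  then show ?thesis by (simp add: D_def)
qed

lemma (in product_prob_space) indep_vars_coordinates:
  assumes "I \<noteq> {}"
  shows "P.indep_vars M (\<lambda>i x. x i) I"
proof (subst P.indep_vars_iff_distr_eq_PiM'[OF assms])
  have "distr (PiM I M) (PiM I M) (\<lambda>x. \<lambda>i\<in>I. x i) = distr (PiM I M) (PiM I M) (\<lambda>x. x)"
    by (rule distr_cong) (auto simp: space_PiM)
  also have "\<dots> = (\<Pi>\<^sub>M i\<in>I. distr (PiM I M) (M i) (\<lambda>x. x i))"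
    unfolding distr_id by (rule PiM_cong) (auto simp: PiM_component)
  finally show "distr (PiM I M) (PiM I M) (\<lambda>x. \<lambda>i\<in>I. x i) = (\<Pi>\<^sub>M i\<in>I. distr (PiM I M) (M i) (\<lambda>x. x i))" .
qed simp

section \<open>Product measures on the sequence space\<close>

definition cantor_product :: "(nat \<Rightarrow> bool pmf) \<Rightarrow> cantor measure" where
  "cantor_product P = distr (PiM {1..} (\<lambda>j. measure_pmf (P j))) borel Abs_cantor"

lemma vimage_Abs_cantor_cylinder:
  "Abs_cantor -` cylinder \<epsilon> n \<inter> space (PiM {1..} (\<lambda>j. measure_pmf (P j)))
    = prod_emb {1..} (\<lambda>j. measure_pmf (P j)) {1..n} (\<Pi>\<^sub>E j\<in>{1..n}. {\<epsilon> j})"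
  by (auto simp: cylinder_def space_PiM Abs_cantor_inverse prod_emb_def PiE_iff simp del: One_nat_def)

lemma measurable_Abs_cantor [measurable]:
  "Abs_cantor \<in> borel_measurable (PiM {1..} (\<lambda>j. measure_pmf (P j)))"
proof (rule borel_measurableI)
  let ?M = "PiM {1..} (\<lambda>j. measure_pmf (P j))"
  fix S :: "cantor set" assume "open S"
  have "Abs_cantor -` C \<inter> space ?M \<in> sets ?M" if C_cyl: "C \<in> cylinders n" for C n
  proof -
    obtain x where "C = cylinder (coord x) n" using C_cyl by (auto simp: cylinders_def)
    then have "Abs_cantor -` C \<inter> space ?M
        = prod_emb {1..} (\<lambda>j. measure_pmf (P j)) {1..n} (\<Pi>\<^sub>E j\<in>{1..n}. {coord x j})"
      by (simp only: vimage_Abs_cantor_cylinder)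
    also have "\<dots> \<in> sets ?M" by (rule sets_PiM_I) auto
    finally show ?thesis .
  qed
  then have "(\<Union>C\<in>{C\<in>\<Union>n. cylinders n. C \<subseteq> S}. Abs_cantor -` C \<inter> space ?M) \<in> sets ?M"
    using countable_subset[OF _ countable_UN_cylinders, of "{C\<in>\<Union>n. cylinders n. C \<subseteq> S}"]
    by (intro sets.countable_UN') auto
  also have "(\<Union>C\<in>{C\<in>\<Union>n. cylinders n. C \<subseteq> S}. Abs_cantor -` C \<inter> space ?M)
      = Abs_cantor -` \<Union>{C\<in>\<Union>n. cylinders n. C \<subseteq> S} \<inter> space ?M" by blast
  also have "\<Union>{C\<in>\<Union>n. cylinders n. C \<subseteq> S} = S"
    by (rule open_eq_Union_cylinders[OF \<open>open S\<close>, symmetric])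
  finally show "Abs_cantor -` S \<inter> space ?M \<in> sets ?M" .
qed

lemma prob_space_cantor_product: "prob_space (cantor_product P)"
proof -
  interpret product_prob_space "\<lambda>j. measure_pmf (P j)" "{1..}" by unfold_locales
  show ?thesis unfolding cantor_product_def by (rule P.prob_space_distr) measurable
qed

lemma sets_cantor_product [simp]: "sets (cantor_product P) = sets borel"
  by (simp add: cantor_product_def)

lemma measure_cantor_product_cylinder:
  "measure (cantor_product P) (cylinder \<epsilon> n) = (\<Prod>j=1..n. pmf (P j) (\<epsilon> j))"
proof -
  interpret product_prob_space "\<lambda>j. measure_pmf (P j)" "{1..}" by unfold_locales
  let ?M = "PiM {1..} (\<lambda>j. measure_pmf (P j))"
  have "measure (cantor_product P) (cylinder \<epsilon> n) = measure ?M (Abs_cantor -` cylinder \<epsilon> n \<inter> space ?M)"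
    unfolding cantor_product_def by (rule measure_distr[OF measurable_Abs_cantor borel_cylinder])
  also have "\<dots> = (\<Prod>j=1..n. measure (P j) {\<epsilon> j})"
    unfolding vimage_Abs_cantor_cylinder by (rule measure_PiM_emb) auto
  finally show ?thesis by (simp add: measure_pmf_single)
qed

theorem cantor_product_strong_law:
  fixes f :: "nat \<Rightarrow> bool \<Rightarrow> real"
  assumes bound: "\<And>j e. \<bar>f j e\<bar> \<le> K"
  shows "AE x in cantor_product P.
    (\<lambda>n. (\<Sum>j=1..n. f j (coord x j) - measure_pmf.expectation (P j) (f j)) / real n) \<longlonglongrightarrow> 0"
proof -
  interpret product_prob_space "\<lambda>j. measure_pmf (P j)" "{1..}" by unfold_locales
  let ?M = "PiM {1..} (\<lambda>j. measure_pmf (P j))"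
  have "P.indep_vars (\<lambda>_. borel) (\<lambda>j x. f j (x j)) {1..}"
    by (rule P.indep_vars_compose2[OF indep_vars_coordinates]) auto
  then have averages: "AE x in ?M.
      (\<lambda>n. (\<Sum>j=1..n. f j (x j) - P.expectation (\<lambda>x. f j (x j))) / real n) \<longlonglongrightarrow> 0"
    by (rule P.strong_law_bounded) (rule bound)
  have expectation: "P.expectation (\<lambda>x. f j (x j)) = measure_pmf.expectation (P j) (f j)"
    if "j \<in> {1..}" for j
    using that integral_distr[of "\<lambda>x. x j" ?M "measure_pmf (P j)" "f j"] PiM_component[OF that]
    by simp
  have "AE x in ?M. (\<lambda>n. (\<Sum>j=1..n. f j (coord (Abs_cantor x) j)
      - measure_pmf.expectation (P j) (f j)) / real n) \<longlonglongrightarrow> 0"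
    using averages AE_space
    by eventually_elim (simp add: Abs_cantor_inverse space_PiM expectation del: One_nat_def)
  moreover have "{x \<in> space borel. (\<lambda>n. (\<Sum>j=1..n. f j (coord x j)
      - measure_pmf.expectation (P j) (f j)) / real n) \<longlonglongrightarrow> 0} \<in> sets borel"
    by measurable
  ultimately show ?thesis
    unfolding cantor_product_def by (subst AE_distr_iff[OF measurable_Abs_cantor])
qed

section \<open>Biased coins and their Gibbs weights\<close>

definition coin :: "real \<Rightarrow> bool pmf" where
  "coin u = bernoulli_pmf (1 - u)"

definition pressure :: "real \<Rightarrow> real \<Rightarrow> real" where
  "pressure u q = log 2 (u powr q + (1 - u) powr q)"

definition gibbs :: "real \<Rightarrow> real \<Rightarrow> bool pmf" where
  "gibbs u q = bernoulli_pmf ((1 - u) powr q / (u powr q + (1 - u) powr q))"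

definition gibbs_mean :: "real \<Rightarrow> real \<Rightarrow> real" where
  "gibbs_mean u q = - measure_pmf.expectation (gibbs u q) (\<lambda>e. log 2 (pmf (coin u) e))"

definition gibbs_entropy :: "real \<Rightarrow> real \<Rightarrow> real" where
  "gibbs_entropy u q = - measure_pmf.expectation (gibbs u q) (\<lambda>e. log 2 (pmf (gibbs u q) e))"

lemma expectation_bool_pmf:
  fixes f :: "bool \<Rightarrow> real"
  shows "measure_pmf.expectation P f = pmf P True * f True + pmf P False * f False"
  by (subst integral_measure_pmf_real[of UNIV]) (auto simp: UNIV_bool mult.commute)

lemma pmf_bool_sum: "pmf P True + pmf P False = 1" for P :: "bool pmf"
  using expectation_bool_pmf[of P "\<lambda>_. 1"] by simp

context
  fixes u :: real
  assumes u_bounds: "0 < u" "u < 1"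
begin

lemma pmf_coin: "pmf (coin u) e = (if e then 1 - u else u)"
  using u_bounds by (cases e) (simp_all add: coin_def)

lemma pmf_coin_pos: "0 < pmf (coin u) e"
  using u_bounds by (simp add: pmf_coin)

lemma partition_pos: "0 < u powr q + (1 - u) powr q"
  using u_bounds by (intro add_pos_pos) auto

lemma powr_pressure: "2 powr pressure u q = u powr q + (1 - u) powr q"
  using partition_pos[of q] by (simp add: pressure_def)

lemma pmf_gibbs_eq_divide: "pmf (gibbs u q) e = pmf (coin u) e powr q / (u powr q + (1 - u) powr q)"
proof -
  have "(1 - u) powr q / (u powr q + (1 - u) powr q) \<in> {0..1}"
    using partition_pos[of q] by (simp add: divide_simps)
  then show ?thesis
    using partition_pos[of q] by (cases e) (simp_all add: gibbs_def pmf_coin field_simps)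
qed

lemma pmf_gibbs: "pmf (gibbs u q) e = pmf (coin u) e powr q * 2 powr (- pressure u q)"
  unfolding pmf_gibbs_eq_divide powr_minus powr_pressure by (simp add: divide_inverse)

lemma pmf_gibbs_pos: "0 < pmf (gibbs u q) e"
  using pmf_coin_pos[of e] by (simp add: pmf_gibbs)

lemma pmf_gibbs_less_1: "pmf (gibbs u q) e < 1"
  using pmf_bool_sum[of "gibbs u q"] pmf_gibbs_pos[of q True] pmf_gibbs_pos[of q False]
  by (cases e) auto

lemma gibbs_entropy_eq: "gibbs_entropy u q = pressure u q + gibbs_mean u q * q"
proof -
  have log_gibbs: "log 2 (pmf (gibbs u q) e) = log 2 (pmf (coin u) e) * q - pressure u q" for e
    using pmf_coin_pos[of e] by (simp add: pmf_gibbs log_mult log_powr mult.commute)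
  have gibbs_True: "pmf (gibbs u q) True = 1 - pmf (gibbs u q) False"
    using pmf_bool_sum[of "gibbs u q"] by simp
  show ?thesis
    unfolding gibbs_entropy_def gibbs_mean_def expectation_bool_pmf log_gibbs gibbs_True
    by (simp add: algebra_simps)
qed

lemma gibbs_entropy_pos: "0 < gibbs_entropy u q"
proof -
  have "pmf (gibbs u q) e * log 2 (pmf (gibbs u q) e) < 0" for e
    using pmf_gibbs_pos pmf_gibbs_less_1 by (intro mult_pos_neg) auto
  then show ?thesis
    unfolding gibbs_entropy_def expectation_bool_pmf neg_0_less_iff_less by (intro add_neg_neg)
qed

lemma pressure_has_real_derivative: "(pressure u has_real_derivative - gibbs_mean u q) (at q)"
proof -
  have "((\<lambda>q. ln (u powr q + (1 - u) powr q) / ln 2) has_real_derivative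
      (u powr q * ln u + (1 - u) powr q * ln (1 - u)) / (u powr q + (1 - u) powr q) / ln 2) (at q)"
    using u_bounds partition_pos[of q] by (auto intro!: derivative_eq_intros)
  also have "(u powr q * ln u + (1 - u) powr q * ln (1 - u)) / (u powr q + (1 - u) powr q) / ln 2
      = - gibbs_mean u q"
    by (simp add: gibbs_mean_def expectation_bool_pmf pmf_gibbs_eq_divide pmf_coin log_def
        add_divide_distrib mult.commute)
  finally show ?thesis by (simp add: pressure_def[abs_def] log_def)
qed

lemma pmf_gibbs_False: "pmf (gibbs u q) False = 1 / (1 + ((1 - u) / u) powr q)"
proof -
  have "0 < u powr q" using u_bounds by simp
  then show ?thesis
    using u_bounds partition_pos[of q]
    by (simp add: pmf_gibbs_eq_divide pmf_coin powr_divide field_simps)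
qed

lemma gibbs_mean_eq:
  "gibbs_mean u q = - log 2 (1 - u) + pmf (gibbs u q) False * (log 2 (1 - u) - log 2 u)"
proof -
  have gibbs_True: "pmf (gibbs u q) True = 1 - pmf (gibbs u q) False"
    using pmf_bool_sum[of "gibbs u q"] by simp
  show ?thesis
    unfolding gibbs_mean_def expectation_bool_pmf gibbs_True by (simp add: pmf_coin algebra_simps)
qed

lemma gibbs_mean_antimono:
  assumes "u \<le> 1/2" "q \<le> q'"
  shows "gibbs_mean u q' \<le> gibbs_mean u q"
proof -
  have "((1 - u) / u) powr q \<le> ((1 - u) / u) powr q'"
    using u_bounds assms by (intro powr_mono) auto
  then have "pmf (gibbs u q') False \<le> pmf (gibbs u q) False"
    unfolding pmf_gibbs_False using u_bounds
    by (intro divide_left_mono) (auto intro!: mult_pos_pos add_pos_nonneg)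
  moreover have "log 2 u \<le> log 2 (1 - u)" using u_bounds assms by simp
  ultimately show ?thesis unfolding gibbs_mean_eq by (intro add_left_mono mult_right_mono) auto
qed

lemma ex_gibbs_mean_eq:
  assumes "u < 1/2" "- log 2 (1 - u) < \<alpha>" "\<alpha> < - log 2 u"
  shows "\<exists>q. gibbs_mean u q = \<alpha>"
proof -
  define w where "w = (\<alpha> + log 2 (1 - u)) / (log 2 (1 - u) - log 2 u)"
  define R where "R = (1 - u) / u"
  have log_gap: "0 < log 2 (1 - u) - log 2 u" using u_bounds assms by simp
  then have w_bounds: "0 < w" "w < 1" using assms by (auto simp: w_def divide_simps)
  have R_gt_1: "1 < R" using u_bounds assms by (simp add: R_def)
  have "0 < 1 / w - 1" using w_bounds by simp
  then have "R powr log R (1 / w - 1) = 1 / w - 1" using R_gt_1 by simp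
  then have "pmf (gibbs u (log R (1 / w - 1))) False = w"
    unfolding pmf_gibbs_False R_def[symmetric] by simp
  then have "gibbs_mean u (log R (1 / w - 1)) = \<alpha>"
    unfolding gibbs_mean_eq using log_gap by (simp add: w_def)
  then show ?thesis ..
qed

end

lemma partition_has_real_derivative:
  assumes "0 < x" "x < 1"
  shows "((\<lambda>x. x powr q + (1 - x) powr q) has_real_derivative
    q * (x powr (q - 1) - (1 - x) powr (q - 1))) (at x)"
  using assms by (auto intro!: derivative_eq_intros simp: algebra_simps)

lemma pressure_antimono_bias:
  assumes biases: "0 < u" "u \<le> v" "v \<le> 1/2" and q_outside: "q \<le> 0 \<or> 1 \<le> q"
  shows "pressure v q \<le> pressure u q"
proof -
  have "v powr q + (1 - v) powr q \<le> u powr q + (1 - u) powr q"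
  proof (rule DERIV_nonpos_imp_nonincreasing[OF biases(2)])
    fix x assume x_between: "u \<le> x" "x \<le> v"
    have "q * (x powr (q - 1) - (1 - x) powr (q - 1)) \<le> 0"
    proof (cases "q \<le> 0")
      case True
      then have "(1 - x) powr (q - 1) \<le> x powr (q - 1)"
        using x_between biases by (intro powr_mono2') auto
      then show ?thesis using True by (simp add: mult_nonpos_nonneg)
    next
      case False
      then have "x powr (q - 1) \<le> (1 - x) powr (q - 1)"
        using x_between biases q_outside by (intro powr_mono2) auto
      then show ?thesis using False by (simp add: mult_nonneg_nonpos)
    qed
    moreover have "0 < x" "x < 1" using x_between biases by auto
    ultimately show "\<exists>y. ((\<lambda>x. x powr q + (1 - x) powr q) has_real_derivative y) (at x) \<and> y \<le> 0"
      using partition_has_real_derivative by blast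
  qed
  then show ?thesis using biases by (simp add: pressure_def add_pos_pos)
qed

lemma pressure_mono_bias:
  assumes biases: "0 < u" "u \<le> v" "v \<le> 1/2" and q_inside: "0 \<le> q" "q \<le> 1"
  shows "pressure u q \<le> pressure v q"
proof -
  have "u powr q + (1 - u) powr q \<le> v powr q + (1 - v) powr q"
  proof (rule DERIV_nonneg_imp_nondecreasing[OF biases(2)])
    fix x assume x_between: "u \<le> x" "x \<le> v"
    have "(1 - x) powr (q - 1) \<le> x powr (q - 1)"
      using x_between biases q_inside by (intro powr_mono2') auto
    then have "0 \<le> q * (x powr (q - 1) - (1 - x) powr (q - 1))" using q_inside by simp
    moreover have "0 < x" "x < 1" using x_between biases by auto
    ultimately show "\<exists>y. ((\<lambda>x. x powr q + (1 - x) powr q) has_real_derivative y) (at x) \<and> 0 \<le> y"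
      using partition_has_real_derivative by blast
  qed
  then show ?thesis using biases by (simp add: pressure_def add_pos_pos)
qed

section \<open>One-sided derivatives\<close>

lemma left_deriv_eqI: "(f has_real_derivative D) (at_left x) \<Longrightarrow> left_deriv f x = D"
  unfolding left_deriv_def by (rule tendsto_Lim) (simp_all add: has_field_derivative_iff)

lemma right_deriv_eqI: "(f has_real_derivative D) (at_right x) \<Longrightarrow> right_deriv f x = D"
  unfolding right_deriv_def by (rule tendsto_Lim) (simp_all add: has_field_derivative_iff)

section \<open>Bernoulli measures with varying bias\<close>

locale bernoulli_measure = prob_space \<mu> for \<mu> :: "cantor measure" +
  fixes \<beta> :: "nat \<Rightarrow> real"
  assumes bias: "0 < \<beta> j" "\<beta> j < 1" and finite_bias: "finite (range \<beta>)"
    and measure_cylinder: "measure \<mu> (cylinder \<epsilon> n) = (\<Prod>j=1..n. pmf (coin (\<beta> j)) (\<epsilon> j))"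
begin

lemma measure_cylinder_pos: "0 < measure \<mu> (cylinder \<epsilon> n)"
  unfolding measure_cylinder by (intro prod_pos) (simp add: pmf_coin_pos bias)

lemma msupport_eq_UNIV: "msupport \<mu> = UNIV"
proof -
  have "emeasure \<mu> (ball x r) \<noteq> 0" if "0 < r" for x r
    using measure_cylinder_pos[of "coord x" "ball_order r"] that
    by (simp add: ball_eq_cylinder emeasure_eq_measure)
  then show ?thesis unfolding msupport_def by auto
qed

lemma partition_sum_eq: "partition_sum \<mu> q n = 2 powr (\<Sum>j=1..n. pressure (\<beta> j) q)"
proof -
  have "partition_sum \<mu> q n = (\<Prod>j=1..n. pmf (coin (\<beta> j)) True powr q + pmf (coin (\<beta> j)) False powr q)"
    unfolding partition_sum_def
    by (rule sum_cylinders_prod) (simp add: measure_cylinder prod_powr_distrib)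
  also have "\<dots> = (\<Prod>j=1..n. 2 powr pressure (\<beta> j) q)"
    by (intro prod.cong) (auto simp: powr_pressure bias pmf_coin)
  finally show ?thesis by (simp add: powr_sum)
qed

lemma mf_b_le_of_frequently:
  assumes "\<And>a. h < a \<Longrightarrow> \<exists>\<^sub>F n in sequentially. (\<Sum>j=1..n. pressure (\<beta> j) q) \<le> a * real n"
  shows "mf_b \<mu> E q \<le> ereal h"
proof (rule ereal_le_epsilon2)
  fix e :: real assume "0 < e"
  then have "mf_b \<mu> E q \<le> ereal (h + e)"
    using assms[of "h + e"] by (intro mf_b_le) (simp add: partition_sum_eq)
  then show "mf_b \<mu> E q \<le> ereal h + ereal e" by simp
qed

lemma mf_B_le_of_pressure_le:
  assumes "\<And>j. pressure (\<beta> j) q \<le> h"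
  shows "mf_B \<mu> E q \<le> ereal h"
proof (rule mf_B_le)
  have "(\<Sum>j=1..n. pressure (\<beta> j) q) \<le> h * real n" for n
    using sum_bounded_above[of "{1..n}" "\<lambda>j. pressure (\<beta> j) q" h] assms by (simp add: mult.commute)
  then show "\<forall>\<^sub>F n in sequentially. partition_sum \<mu> q n \<le> 2 powr (h * real n)"
    by (simp add: partition_sum_eq)
qed

subsection \<open>Gibbs measures\<close>

definition gibbs_measure :: "(real \<Rightarrow> real) \<Rightarrow> cantor measure" where
  "gibbs_measure Q = cantor_product (\<lambda>j. gibbs (\<beta> j) (Q (\<beta> j)))"

lemma prob_space_gibbs_measure: "prob_space (gibbs_measure Q)"
  unfolding gibbs_measure_def by (rule prob_space_cantor_product)

lemma sets_gibbs_measure: "sets (gibbs_measure Q) = sets borel"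
  by (simp add: gibbs_measure_def)

lemma measure_gibbs_measure_cylinder:
  "measure (gibbs_measure Q) (cylinder \<epsilon> n) = (\<Prod>j=1..n. pmf (gibbs (\<beta> j) (Q (\<beta> j))) (\<epsilon> j))"
  by (simp add: gibbs_measure_def measure_cantor_product_cylinder)

lemma measure_gibbs_measure_const_cylinder:
  "measure (gibbs_measure (\<lambda>_. q)) (cylinder \<epsilon> n)
    = measure \<mu> (cylinder \<epsilon> n) powr q * 2 powr (- (\<Sum>j=1..n. pressure (\<beta> j) q))"
  unfolding measure_gibbs_measure_cylinder measure_cylinder
  by (simp add: pmf_gibbs bias prod.distrib prod_powr_distrib powr_sum sum_negf[symmetric])

lemma gibbs_measure_strong_law:
  fixes f :: "real \<Rightarrow> bool \<Rightarrow> real"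
  shows "AE x in gibbs_measure Q. (\<lambda>n. (\<Sum>j=1..n. f (\<beta> j) (coord x j)
    - measure_pmf.expectation (gibbs (\<beta> j) (Q (\<beta> j))) (f (\<beta> j))) / real n) \<longlonglongrightarrow> 0"
proof -
  have "finite ((\<lambda>(u, e). \<bar>f u e\<bar>) ` (range \<beta> \<times> UNIV))" using finite_bias by simp
  then have "\<bar>f (\<beta> j) e\<bar> \<le> Max ((\<lambda>(u, e). \<bar>f u e\<bar>) ` (range \<beta> \<times> UNIV))" for j e
    by (rule Max_ge) auto
  then show ?thesis unfolding gibbs_measure_def by (rule cantor_product_strong_law)
qed

lemma log_measure_cylinder:
  "log 2 (measure \<mu> (cylinder \<epsilon> n)) = (\<Sum>j=1..n. log 2 (pmf (coin (\<beta> j)) (\<epsilon> j)))"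
  unfolding measure_cylinder log_def
  by (subst ln_prod) (use pmf_coin_pos[OF bias] in \<open>auto simp: sum_divide_distrib less_le\<close>)

lemma AE_gibbs_measure_level_set:
  assumes mean: "\<forall>u\<in>range \<beta>. gibbs_mean u (Q u) = \<alpha>"
  shows "AE x in gibbs_measure Q. x \<in> level_set \<mu> \<alpha>"
  using gibbs_measure_strong_law[of "\<lambda>u e. log 2 (pmf (coin u) e)" Q]
proof eventually_elim
  case (elim x)
  have "measure_pmf.expectation (gibbs (\<beta> j) (Q (\<beta> j))) (\<lambda>e. log 2 (pmf (coin (\<beta> j)) e)) = - \<alpha>" for j
    using mean by (simp add: gibbs_mean_def minus_equation_iff)
  with elim have "(\<lambda>n. (\<Sum>j=1..n. log 2 (pmf (coin (\<beta> j)) (coord x j)) - - \<alpha>) / real n) \<longlonglongrightarrow> 0" by simp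
  then have "(\<lambda>n. \<alpha> - (\<Sum>j=1..n. log 2 (pmf (coin (\<beta> j)) (coord x j)) - - \<alpha>) / real n) \<longlonglongrightarrow> \<alpha> - 0"
    by (intro tendsto_intros)
  moreover have "\<forall>\<^sub>F n in sequentially. \<alpha> - (\<Sum>j=1..n. log 2 (pmf (coin (\<beta> j)) (coord x j)) - - \<alpha>) / real n
      = - log 2 (measure \<mu> (cylinder (coord x) n)) / real n"
    using eventually_gt_at_top[of 0]
    by eventually_elim (simp add: log_measure_cylinder sum.distrib field_simps)
  ultimately have "(\<lambda>n. - log 2 (measure \<mu> (cylinder (coord x) n)) / real n) \<longlonglongrightarrow> \<alpha> - 0"
    by (rule Lim_transform_eventually)
  then show ?case by (intro level_setI) simp
qed

lemma AE_gibbs_measure_local_entropy: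
  assumes "0 < e"
  shows "AE x in gibbs_measure Q. \<forall>\<^sub>F n in sequentially. measure (gibbs_measure Q) (cylinder (coord x) n)
    \<le> 2 powr (e * real n - (\<Sum>j=1..n. gibbs_entropy (\<beta> j) (Q (\<beta> j))))"
  using gibbs_measure_strong_law[of "\<lambda>u c. log 2 (pmf (gibbs u (Q u)) c)" Q]
proof eventually_elim
  case (elim x)
  define S where "S n = (\<Sum>j=1..n. log 2 (pmf (gibbs (\<beta> j) (Q (\<beta> j))) (coord x j)))" for n
  define H where "H n = (\<Sum>j=1..n. gibbs_entropy (\<beta> j) (Q (\<beta> j)))" for n
  have "(\<lambda>n. (S n + H n) / real n) \<longlonglongrightarrow> 0"
    using elim by (simp add: S_def H_def gibbs_entropy_def sum_subtractf sum_negf)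
  then have "\<forall>\<^sub>F n in sequentially. (S n + H n) / real n < e"
    using assms by (rule order_tendstoD)
  then show ?case
    using eventually_gt_at_top[of 0]
  proof eventually_elim
    case (elim n)
    have "measure (gibbs_measure Q) (cylinder (coord x) n) = 2 powr S n"
      unfolding measure_gibbs_measure_cylinder S_def powr_sum[OF zero_neq_numeral[symmetric]]
      by (intro prod.cong) (auto simp: pmf_gibbs_pos bias)
    also have "\<dots> \<le> 2 powr (e * real n - H n)"
      using elim by (intro powr_mono) (auto simp: field_simps)
    finally show ?case by (simp add: H_def)
  qed
qed

theorem le_hausdorff_dim_level_set:
  assumes mean: "\<forall>u\<in>range \<beta>. gibbs_mean u (Q u) = \<alpha>"
    and h_le: "\<forall>u\<in>range \<beta>. h \<le> gibbs_entropy u (Q u)"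
  shows "ereal h \<le> hausdorff_dim (level_set \<mu> \<alpha>)"
proof (rule le_hausdorff_dimI)
  fix s assume "0 < s" "s < h"
  have sum_ge: "h * real n \<le> (\<Sum>j=1..n. gibbs_entropy (\<beta> j) (Q (\<beta> j)))" for n
    using sum_bounded_below[of "{1..n}" h "\<lambda>j. gibbs_entropy (\<beta> j) (Q (\<beta> j))"] h_le
    by (simp add: mult.commute)
  have "AE x in gibbs_measure Q. \<forall>\<^sub>F n in sequentially. measure (gibbs_measure Q) (cylinder (coord x) n)
      \<le> 2 powr ((h - s) * real n - (\<Sum>j=1..n. gibbs_entropy (\<beta> j) (Q (\<beta> j))))"
    by (rule AE_gibbs_measure_local_entropy) (use \<open>s < h\<close> in simp)
  with AE_gibbs_measure_level_set[OF mean] have "AE x in gibbs_measure Q. x \<in> level_set \<mu> \<alpha> \<and>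
      (\<forall>\<^sub>F n in sequentially. measure (gibbs_measure Q) (cylinder (coord x) n) \<le> ((1/2) ^ n) powr s)"
  proof eventually_elim
    case (elim x)
    have "2 powr ((h - s) * real n - (\<Sum>j=1..n. gibbs_entropy (\<beta> j) (Q (\<beta> j)))) \<le> ((1/2) ^ n) powr s" for n
      unfolding half_power_powr using sum_ge[of n] by (intro powr_mono) (auto simp: algebra_simps)
    then show ?case using elim by (auto elim!: eventually_mono intro: order.trans)
  qed
  then show "hausdorff_measure s (level_set \<mu> \<alpha>) \<noteq> 0"
    by (rule hausdorff_measure_neq_0_of_density[OF prob_space_gibbs_measure sets_gibbs_measure \<open>0 < s\<close>])
qed

lemma mf_gauge_cylinder_radius:
  "mf_gauge \<mu> q t x (cylinder_radius n)
    = 2 powr t * 2 powr (- (t * real n)) * measure \<mu> (cylinder (coord x) n) powr q"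
  unfolding mf_gauge_def ball_cylinder_radius
  by (simp add: cylinder_radius_def powr_mult half_power_powr)

theorem le_packing_dim_level_set:
  assumes mean: "\<forall>u\<in>range \<beta>. gibbs_mean u (Q u) = \<alpha>"
    and frequently: "\<And>a. a < h \<Longrightarrow>
      \<exists>\<^sub>F n in sequentially. a * real n < (\<Sum>j=1..n. gibbs_entropy (\<beta> j) (Q (\<beta> j)))"
  shows "ereal h \<le> packing_dim (level_set \<mu> \<alpha>)"
proof (rule le_packing_dimI)
  fix s assume "s < h"
  define e where "e = (h - s) / 2"
  have "0 < e" "s + e < h" using \<open>s < h\<close> by (auto simp: e_def field_simps)
  have "AE x in gibbs_measure Q. x \<in> level_set \<mu> \<alpha> \<and> (\<exists>\<^sub>F n in sequentially.
      measure (gibbs_measure Q) (cylinder (coord x) n)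
        \<le> 2 powr (- s) * mf_gauge \<mu> 0 s x (cylinder_radius n))"
    using AE_gibbs_measure_level_set[OF mean] AE_gibbs_measure_local_entropy[OF \<open>0 < e\<close>]
  proof eventually_elim
    case (elim x)
    show ?case
    proof
      show "\<exists>\<^sub>F n in sequentially. measure (gibbs_measure Q) (cylinder (coord x) n)
          \<le> 2 powr (- s) * mf_gauge \<mu> 0 s x (cylinder_radius n)"
        using frequently_eventually_frequently[OF frequently[OF \<open>s + e < h\<close>] elim(2)]
      proof (rule frequently_elim1)
        fix n assume "(s + e) * real n < (\<Sum>j=1..n. gibbs_entropy (\<beta> j) (Q (\<beta> j))) \<and>
          measure (gibbs_measure Q) (cylinder (coord x) n)
            \<le> 2 powr (e * real n - (\<Sum>j=1..n. gibbs_entropy (\<beta> j) (Q (\<beta> j))))"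
        then have "measure (gibbs_measure Q) (cylinder (coord x) n) \<le> 2 powr (- (s * real n))"
          by (elim conjE order.trans) (intro powr_mono, auto simp: algebra_simps)
        then show "measure (gibbs_measure Q) (cylinder (coord x) n)
            \<le> 2 powr (- s) * mf_gauge \<mu> 0 s x (cylinder_radius n)"
          using measure_cylinder_pos[of "coord x" n]
          by (simp add: mf_gauge_cylinder_radius mult.assoc[symmetric] powr_add[symmetric])
      qed
    qed (rule elim(1))
  qed
  then have "mf_packing \<mu> 0 s (level_set \<mu> \<alpha>) \<noteq> 0"
    by (rule mf_packing_neq_0_of_density[OF prob_space_gibbs_measure sets_gibbs_measure, rotated]) simp
  then show "packing_measure s (level_set \<mu> \<alpha>) \<noteq> 0"
    using mf_packing_0_le_packing_measure[of \<mu> s "level_set \<mu> \<alpha>"] by auto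
qed

theorem le_mf_B:
  assumes frequently: "\<And>a. a < h \<Longrightarrow> \<exists>\<^sub>F n in sequentially. a * real n < (\<Sum>j=1..n. pressure (\<beta> j) q)"
  shows "ereal h \<le> mf_B \<mu> UNIV q"
  unfolding mf_B_def
proof (rule le_Inf_ereal_Collect)
  fix s assume "s < h"
  show "mf_packing \<mu> q s UNIV \<noteq> 0"
  proof (rule mf_packing_neq_0_of_density[OF prob_space_gibbs_measure sets_gibbs_measure])
    show "AE x in gibbs_measure (\<lambda>_. q). x \<in> UNIV \<and> (\<exists>\<^sub>F n in sequentially.
        measure (gibbs_measure (\<lambda>_. q)) (cylinder (coord x) n)
          \<le> 2 powr (- s) * mf_gauge \<mu> q s x (cylinder_radius n))"
    proof (intro always_eventually allI conjI UNIV_I frequently_elim1[OF frequently[OF \<open>s < h\<close>]])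
      fix x n assume "s * real n < (\<Sum>j=1..n. pressure (\<beta> j) q)"
      then have "measure (gibbs_measure (\<lambda>_. q)) (cylinder (coord x) n)
          \<le> measure \<mu> (cylinder (coord x) n) powr q * 2 powr (- (s * real n))"
        unfolding measure_gibbs_measure_const_cylinder by (intro mult_left_mono powr_mono) auto
      also have "\<dots> = 2 powr (- s) * mf_gauge \<mu> q s x (cylinder_radius n)"
        by (simp add: mf_gauge_cylinder_radius mult.assoc[symmetric] powr_add[symmetric])
      finally show "measure (gibbs_measure (\<lambda>_. q)) (cylinder (coord x) n)
          \<le> 2 powr (- s) * mf_gauge \<mu> q s x (cylinder_radius n)" .
    qed
  qed simp
qed

end

subsection \<open>Biases recurring in dominant blocks\<close>

lemma block_average_tendsto:
  fixes v :: "nat \<Rightarrow> real"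
  assumes bound: "\<And>j. \<bar>v j - a\<bar> \<le> C" and block: "\<And>k j. j \<in> {l k..n k} \<Longrightarrow> v j = a"
    and n_at_top: "filterlim n at_top sequentially" and ratio: "(\<lambda>k. real (l k) / real (n k)) \<longlonglongrightarrow> 0"
  shows "(\<lambda>k. (\<Sum>j=1..n k. v j) / real (n k)) \<longlonglongrightarrow> a"
proof -
  have "0 \<le> C" using bound[of 0] by linarith
  have deviation: "\<bar>\<Sum>j=1..n k. v j - a\<bar> \<le> C * real (l k)" for k
  proof -
    have "\<bar>\<Sum>j=1..n k. v j - a\<bar> \<le> (\<Sum>j=1..n k. \<bar>v j - a\<bar>)" by (rule sum_abs)
    also have "\<dots> = (\<Sum>j\<in>{1..n k} \<inter> {..<l k}. \<bar>v j - a\<bar>)"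
      using block by (intro sum.mono_neutral_right) (auto, metis not_le)
    also have "\<dots> \<le> real (card ({1..n k} \<inter> {..<l k})) * C"
      using bound by (intro sum_bounded_above)
    also have "\<dots> \<le> real (l k) * C"
      using card_mono[of "{..<l k}" "{1..n k} \<inter> {..<l k}"] \<open>0 \<le> C\<close> by (intro mult_right_mono) auto
    finally show ?thesis by (simp add: mult.commute)
  qed
  have "(\<lambda>k. (\<Sum>j=1..n k. v j) / real (n k) - a) \<longlonglongrightarrow> 0"
  proof (rule Lim_null_comparison)
    have "\<forall>\<^sub>F k in sequentially. 1 \<le> n k" using n_at_top unfolding filterlim_at_top by blast
    then show "\<forall>\<^sub>F k in sequentially.
        norm ((\<Sum>j=1..n k. v j) / real (n k) - a) \<le> C * (real (l k) / real (n k))"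
    proof eventually_elim
      case (elim k)
      then have "(\<Sum>j=1..n k. v j) / real (n k) - a = (\<Sum>j=1..n k. v j - a) / real (n k)"
        by (simp add: sum_subtractf field_simps)
      then show ?case using divide_right_mono[OF deviation[of k], of "real (n k)"] by simp
    qed
    show "(\<lambda>k. C * (real (l k) / real (n k))) \<longlonglongrightarrow> 0"
      using tendsto_mult_right_zero[OF ratio] .
  qed
  then show ?thesis by (simp add: LIM_zero_iff)
qed

definition dominant_value :: "(nat \<Rightarrow> 'a) \<Rightarrow> 'a \<Rightarrow> bool" where
  "dominant_value f u \<longleftrightarrow> (\<exists>l n. (\<forall>k. \<forall>j\<in>{l k..n k}. f j = u) \<and> filterlim n at_top sequentially
    \<and> (\<lambda>k. real (l k) / real (n k)) \<longlonglongrightarrow> 0)"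

lemma dominant_valueI:
  assumes "\<And>k j. j \<in> {l k..n k} \<Longrightarrow> f j = u" "filterlim n at_top sequentially"
    and "(\<lambda>k. real (l k) / real (n k)) \<longlonglongrightarrow> 0"
  shows "dominant_value f u"
  unfolding dominant_value_def by (rule exI[of _ l], rule exI[of _ n]) (use assms in auto)

lemma frequently_less_sum_of_dominant_value:
  fixes g :: "'a \<Rightarrow> real"
  assumes finite: "finite (range f)" and dominant: "dominant_value f u" and a_less: "a < g u"
  shows "\<exists>\<^sub>F m in sequentially. a * real m < (\<Sum>j=1..m. g (f j))"
proof -
  obtain l n where block: "\<And>k j. j \<in> {l k..n k} \<Longrightarrow> f j = u"
    and n_at_top: "filterlim n at_top sequentially"
    and ratio: "(\<lambda>k. real (l k) / real (n k)) \<longlonglongrightarrow> 0"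
    using dominant unfolding dominant_value_def by blast
  have "\<bar>g (f j) - g u\<bar> \<le> Max ((\<lambda>w. \<bar>g w - g u\<bar>) ` range f)" for j
    using finite by (intro Max_ge) auto
  then have "(\<lambda>k. (\<Sum>j=1..n k. g (f j)) / real (n k)) \<longlonglongrightarrow> g u"
    by (rule block_average_tendsto[OF _ _ n_at_top ratio]) (simp add: block)
  then have "\<forall>\<^sub>F k in sequentially. a < (\<Sum>j=1..n k. g (f j)) / real (n k)"
    using a_less by (rule order_tendstoD)
  moreover have "\<forall>\<^sub>F k in sequentially. 1 \<le> n k" using n_at_top unfolding filterlim_at_top by blast
  ultimately have "\<forall>\<^sub>F k in sequentially. a * real (n k) < (\<Sum>j=1..n k. g (f j))"
    by eventually_elim (simp add: pos_less_divide_eq)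
  then have "\<exists>\<^sub>F k in sequentially. a * real (n k) < (\<Sum>j=1..n k. g (f j))"
    by (simp add: eventually_frequently)
  then show ?thesis
    using eventually_compose_filterlim[OF _ n_at_top] unfolding frequently_def by blast
qed

locale dominant_bernoulli_measure = bernoulli_measure +
  assumes dominant: "u \<in> range \<beta> \<Longrightarrow> dominant_value \<beta> u"
begin

lemma mf_b_le_pressure:
  assumes "u \<in> range \<beta>"
  shows "mf_b \<mu> E q \<le> ereal (pressure u q)"
proof (rule mf_b_le_of_frequently)
  fix a assume "pressure u q < a"
  then have "\<exists>\<^sub>F n in sequentially. - a * real n < (\<Sum>j=1..n. - pressure (\<beta> j) q)"
    by (intro frequently_less_sum_of_dominant_value[OF finite_bias dominant[OF assms]]) simp
  then show "\<exists>\<^sub>F n in sequentially. (\<Sum>j=1..n. pressure (\<beta> j) q) \<le> a * real n"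
    by (rule frequently_elim1) (simp add: sum_negf)
qed

lemma mf_B_eq_pressure:
  assumes u_bias: "u \<in> range \<beta>" and u_max: "\<forall>v\<in>range \<beta>. pressure v q \<le> pressure u q"
  shows "mf_B \<mu> UNIV q = ereal (pressure u q)"
proof (rule antisym)
  show "mf_B \<mu> UNIV q \<le> ereal (pressure u q)" using u_max by (intro mf_B_le_of_pressure_le) simp
  show "ereal (pressure u q) \<le> mf_B \<mu> UNIV q"
    by (intro le_mf_B frequently_less_sum_of_dominant_value[OF finite_bias dominant[OF u_bias]])
qed

end

lemma eq_INF_of_le_max_0:
  fixes d :: ereal
  assumes h_pos: "0 < h" and h_le: "ereal h \<le> d" and le_max: "\<And>q. d \<le> max 0 (f q)"
    and attained: "f q\<^sub>0 \<le> ereal h"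
  shows "d = (INF q. f q)"
proof (rule antisym)
  have "0 < d" using h_pos h_le less_le_trans[of 0 "ereal h" d] by simp
  then have "d \<le> f q" for q using le_max[of q] by (auto simp: le_max_iff_disj)
  then show "d \<le> (INF q. f q)" by (rule INF_greatest)
  have "(INF q. f q) \<le> f q\<^sub>0" by (rule INF_lower) simp
  then show "(INF q. f q) \<le> d" using attained h_le by (rule order.trans[OF order.trans])
qed

context dominant_bernoulli_measure
begin

theorem hausdorff_dim_level_set:
  assumes mean: "\<forall>u\<in>range \<beta>. gibbs_mean u (Q u) = \<alpha>"
  shows "hausdorff_dim (level_set \<mu> \<alpha>) = (INF q. mf_b \<mu> UNIV q + ereal (\<alpha> * q))"
proof -
  obtain u where u_bias: "u \<in> range \<beta>"
    and u_min: "\<forall>v\<in>range \<beta>. gibbs_entropy u (Q u) \<le> gibbs_entropy v (Q v)"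
    using arg_min_if_finite[OF finite_bias, of "\<lambda>u. gibbs_entropy u (Q u)"] by (auto simp: not_less)
  show ?thesis
  proof (rule eq_INF_of_le_max_0)
    show "0 < gibbs_entropy u (Q u)" using u_bias bias by (auto intro: gibbs_entropy_pos)
    show "ereal (gibbs_entropy u (Q u)) \<le> hausdorff_dim (level_set \<mu> \<alpha>)"
      by (rule le_hausdorff_dim_level_set[OF mean u_min])
    show "hausdorff_dim (level_set \<mu> \<alpha>) \<le> max 0 (mf_b \<mu> UNIV q + ereal (\<alpha> * q))" for q
      using hausdorff_dim_level_set_le[OF finite_measure_axioms, of \<alpha> q]
      by (simp add: msupport_eq_UNIV)
    have "mf_b \<mu> UNIV (Q u) + ereal (\<alpha> * Q u) \<le> ereal (pressure u (Q u)) + ereal (\<alpha> * Q u)"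
      by (intro add_right_mono mf_b_le_pressure u_bias)
    also have "\<dots> = ereal (gibbs_entropy u (Q u))"
      using u_bias bias mean by (auto simp: gibbs_entropy_eq)
    finally show "mf_b \<mu> UNIV (Q u) + ereal (\<alpha> * Q u) \<le> ereal (gibbs_entropy u (Q u))" .
  qed
qed

theorem packing_dim_level_set:
  assumes mean: "\<forall>u\<in>range \<beta>. gibbs_mean u (Q u) = \<alpha>"
    and u_bias: "u \<in> range \<beta>" and u_max: "\<forall>v\<in>range \<beta>. pressure v (Q u) \<le> pressure u (Q u)"
  shows "packing_dim (level_set \<mu> \<alpha>) = (INF q. mf_B \<mu> UNIV q + ereal (\<alpha> * q))"
proof (rule eq_INF_of_le_max_0)
  show "0 < gibbs_entropy u (Q u)" using u_bias bias by (auto intro: gibbs_entropy_pos)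
  show "ereal (gibbs_entropy u (Q u)) \<le> packing_dim (level_set \<mu> \<alpha>)"
    by (intro le_packing_dim_level_set[OF mean]
        frequently_less_sum_of_dominant_value[OF finite_bias dominant[OF u_bias]])
  show "packing_dim (level_set \<mu> \<alpha>) \<le> max 0 (mf_B \<mu> UNIV q + ereal (\<alpha> * q))" for q
    using packing_dim_level_set_le[OF finite_measure_axioms, of \<alpha> q] by (simp add: msupport_eq_UNIV)
  show "mf_B \<mu> UNIV (Q u) + ereal (\<alpha> * Q u) \<le> ereal (gibbs_entropy u (Q u))"
    using u_bias bias mean by (auto simp: mf_B_eq_pressure[OF u_bias u_max] gibbs_entropy_eq)
qed

end

section \<open>Two alternating biases\<close>

locale two_bias_measure = dominant_bernoulli_measure +
  fixes p pt :: real
  assumes range_bias: "range \<beta> = {p, pt}" and biases: "0 < p" "p < pt" "pt \<le> 1/2"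
begin

lemma mf_B_outside_unit_interval: "q \<le> 0 \<or> 1 \<le> q \<Longrightarrow> mf_B \<mu> UNIV q = ereal (pressure p q)"
  using pressure_antimono_bias[of p pt q] biases by (intro mf_B_eq_pressure) (auto simp: range_bias)

lemma mf_B_on_unit_interval: "0 \<le> q \<Longrightarrow> q \<le> 1 \<Longrightarrow> mf_B \<mu> UNIV q = ereal (pressure pt q)"
  using pressure_mono_bias[of p pt q] biases by (intro mf_B_eq_pressure) (auto simp: range_bias)

lemma one_sided_derivs_mf_B:
  defines "B \<equiv> \<lambda>q. real_of_ereal (mf_B \<mu> UNIV q)"
  shows "left_deriv B 0 = - gibbs_mean p 0" "right_deriv B 0 = - gibbs_mean pt 0"
    and "left_deriv B 1 = - gibbs_mean pt 1" "right_deriv B 1 = - gibbs_mean p 1"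
proof -
  have outside: "B q = pressure p q" if "q \<le> 0 \<or> 1 \<le> q" for q
    using mf_B_outside_unit_interval that by (simp add: B_def)
  have inside: "B q = pressure pt q" if "0 \<le> q" "q \<le> 1" for q
    using mf_B_on_unit_interval that by (simp add: B_def)
  have derivI: "(B has_real_derivative - gibbs_mean u q) (at q within S)"
    if "0 < u" "u < 1" "B q = pressure u q" "\<forall>\<^sub>F y in at q within S. B y = pressure u y" for u q S
    using has_field_derivative_at_within[OF pressure_has_real_derivative[OF that(1,2)]]
      has_field_derivative_cong_eventually[OF that(4,3)] by blast
  have "\<forall>\<^sub>F y in at_left 0. B y = pressure p y"
    using eventually_at_left_real[of "- 1" 0] by (rule eventually_mono) (auto intro: outside)
  then show "left_deriv B 0 = - gibbs_mean p 0"
    using biases by (intro left_deriv_eqI derivI outside) auto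
  have "\<forall>\<^sub>F y in at_right 0. B y = pressure pt y"
    using eventually_at_right_real[of 0 1] by (rule eventually_mono) (auto intro: inside)
  then show "right_deriv B 0 = - gibbs_mean pt 0"
    using biases by (intro right_deriv_eqI derivI inside) auto
  have "\<forall>\<^sub>F y in at_left 1. B y = pressure pt y"
    using eventually_at_left_real[of 0 1] by (rule eventually_mono) (auto intro: inside)
  then show "left_deriv B 1 = - gibbs_mean pt 1"
    using biases by (intro left_deriv_eqI derivI inside) auto
  have "\<forall>\<^sub>F y in at_right 1. B y = pressure p y"
    using eventually_at_right_real[of 1 2] by (rule eventually_mono) (auto intro: outside)
  then show "right_deriv B 1 = - gibbs_mean p 1"
    using biases by (intro right_deriv_eqI derivI outside) auto
qed

lemma ex_gibbs_mean_eq_both: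
  assumes "- log 2 (1 - pt) < \<alpha>" "\<alpha> < - log 2 pt"
  obtains Q where "\<forall>u\<in>range \<beta>. gibbs_mean u (Q u) = \<alpha>"
proof -
  have "\<exists>q. gibbs_mean u q = \<alpha>" if "u \<in> range \<beta>" for u
  proof -
    have "0 < u" "u \<le> pt" using that biases by (auto simp: range_bias)
    have "log 2 pt < log 2 (1 - pt)" using assms by linarith
    then have "u < 1/2" using \<open>0 < u\<close> \<open>u \<le> pt\<close> biases by simp
    moreover have "log 2 (1 - pt) \<le> log 2 (1 - u)" "log 2 u \<le> log 2 pt"
      using \<open>0 < u\<close> \<open>u \<le> pt\<close> biases by auto
    ultimately show ?thesis using \<open>0 < u\<close> assms by (intro ex_gibbs_mean_eq) linarith+
  qed
  then show thesis using that by metis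
qed

lemma ex_dominating_bias:
  assumes mean: "\<forall>u\<in>range \<beta>. gibbs_mean u (Q u) = \<alpha>"
    and ends: "\<alpha> \<notin> {gibbs_mean pt 0..gibbs_mean p 0} \<union> {gibbs_mean p 1..gibbs_mean pt 1}"
  obtains u where "u \<in> range \<beta>" "\<forall>v\<in>range \<beta>. pressure v (Q u) \<le> pressure u (Q u)"
proof -
  have mean_Q: "gibbs_mean p (Q p) = \<alpha>" "gibbs_mean pt (Q pt) = \<alpha>"
    using mean by (auto simp: range_bias)
  consider (p_outside) "Q p \<le> 0 \<or> 1 \<le> Q p" | (pt_inside) "0 \<le> Q pt" "Q pt \<le> 1"
    | (crossing) "0 \<le> Q p" "Q p \<le> 1" "Q pt \<le> 0 \<or> 1 \<le> Q pt"
    by linarith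
  then show thesis
  proof cases
    case p_outside
    then show thesis
      using pressure_antimono_bias[of p pt "Q p"] biases
      by (intro that[of p]) (auto simp: range_bias)
  next
    case pt_inside
    then show thesis
      using pressure_mono_bias[of p pt "Q pt"] biases by (intro that[of pt]) (auto simp: range_bias)
  next
    case crossing
    then have "\<alpha> \<le> gibbs_mean p 0" "gibbs_mean p 1 \<le> \<alpha>"
      using biases unfolding mean_Q(1)[symmetric] by (auto intro!: gibbs_mean_antimono)
    moreover have "gibbs_mean pt 0 \<le> \<alpha> \<or> \<alpha> \<le> gibbs_mean pt 1"
      using biases crossing(3) unfolding mean_Q(2)[symmetric] by (auto intro!: gibbs_mean_antimono)
    ultimately show thesis using ends by auto
  qed
qed

theorem hausdorff_dim_level_set_eq:
  assumes "- log 2 (1 - pt) < \<alpha>" "\<alpha> < - log 2 pt"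
  shows "hausdorff_dim (level_set \<mu> \<alpha>) = (INF q. mf_b \<mu> UNIV q + ereal (\<alpha> * q))"
proof -
  obtain Q where "\<forall>u\<in>range \<beta>. gibbs_mean u (Q u) = \<alpha>" using ex_gibbs_mean_eq_both[OF assms] .
  then show ?thesis by (rule hausdorff_dim_level_set)
qed

theorem packing_dim_level_set_eq:
  assumes "- log 2 (1 - pt) < \<alpha>" "\<alpha> < - log 2 pt"
    and ends: "\<alpha> \<notin> {gibbs_mean pt 0..gibbs_mean p 0} \<union> {gibbs_mean p 1..gibbs_mean pt 1}"
  shows "packing_dim (level_set \<mu> \<alpha>) = (INF q. mf_B \<mu> UNIV q + ereal (\<alpha> * q))"
proof -
  obtain Q where mean: "\<forall>u\<in>range \<beta>. gibbs_mean u (Q u) = \<alpha>"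
    using ex_gibbs_mean_eq_both[OF assms(1,2)] .
  obtain u where "u \<in> range \<beta>" "\<forall>v\<in>range \<beta>. pressure v (Q u) \<le> pressure u (Q u)"
    using ex_dominating_bias[OF mean ends] .
  with mean show ?thesis by (rule packing_dim_level_set)
qed

end

definition alternating_bias :: "(nat \<Rightarrow> nat) \<Rightarrow> real \<Rightarrow> real \<Rightarrow> nat \<Rightarrow> real" where
  "alternating_bias t p pt j = (if \<exists>k. t (2 * k + 1) \<le> j \<and> j < t (2 * k + 2) then p else pt)"

lemma tendsto_ratio_pred:
  fixes a b :: "nat \<Rightarrow> nat"
  assumes "(\<lambda>k. real (a k) / real (b k)) \<longlonglongrightarrow> 0" and ge_2: "\<forall>\<^sub>F k in sequentially. 2 \<le> b k"
  shows "(\<lambda>k. real (a k) / real (b k - 1)) \<longlonglongrightarrow> 0"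
proof (rule Lim_null_comparison)
  show "(\<lambda>k. 2 * (real (a k) / real (b k))) \<longlonglongrightarrow> 0"
    using assms(1) by (rule tendsto_mult_right_zero)
  show "\<forall>\<^sub>F k in sequentially. norm (real (a k) / real (b k - 1)) \<le> 2 * (real (a k) / real (b k))"
    using ge_2
  proof eventually_elim
    case (elim k)
    then have "real (b k) \<le> 2 * real (b k - 1)" "0 < real (b k - 1)" by (auto simp: of_nat_diff)
    then have "real (a k) / real (b k - 1) \<le> real (a k) / (real (b k) / 2)"
      using elim by (intro divide_left_mono) auto
    then show ?case by (simp add: mult.commute)
  qed
qed

context
  fixes t :: "nat \<Rightarrow> nat" and p pt :: real
  assumes t_mono: "strict_mono t"
begin

lemma alternating_bias_odd: "t (2 * k + 1) \<le> j \<Longrightarrow> j < t (2 * k + 2) \<Longrightarrow> alternating_bias t p pt j = p"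
  unfolding alternating_bias_def by auto

lemma block_unique:
  assumes "t m \<le> j" "j < t (Suc m)" "t n \<le> j" "j < t (Suc n)"
  shows "m = n"
proof -
  have "t m < t (Suc n)" "t n < t (Suc m)" using assms by linarith+
  then show ?thesis using strict_mono_less[OF t_mono] by (simp add: less_Suc_eq_le)
qed

lemma alternating_bias_even:
  assumes "t (2 * k) \<le> j" "j < t (2 * k + 1)"
  shows "alternating_bias t p pt j = pt"
proof -
  have False if "t (2 * i + 1) \<le> j" "j < t (2 * i + 2)" for i
    using block_unique[of "2 * k" j "2 * i + 1"] assms that by (auto; presburger)
  then show ?thesis by (auto simp: alternating_bias_def)
qed

lemma ex_block:
  assumes "t 0 \<le> j"
  obtains n where "t n \<le> j" "j < t (Suc n)"
proof -
  define n where "n = (LEAST n. j < t n)"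
  have "j < t (Suc j)" using strict_mono_imp_increasing[OF t_mono, of "Suc j"] by simp
  then have less_n: "j < t n" unfolding n_def by (rule LeastI)
  then obtain m where n_eq: "n = Suc m" using assms by (cases n) auto
  have "\<not> j < t m" using not_less_Least[of m "\<lambda>n. j < t n"] n_eq by (simp add: n_def)
  then show thesis using that[of m] less_n n_eq by simp
qed

lemma range_alternating_bias: "range (alternating_bias t p pt) = {p, pt}"
proof
  show "range (alternating_bias t p pt) \<subseteq> {p, pt}" by (auto simp: alternating_bias_def)
  have "alternating_bias t p pt (t (2 * 0 + 1)) = p"
    by (rule alternating_bias_odd[of 0]) (auto intro: strict_monoD[OF t_mono])
  moreover have "alternating_bias t p pt (t (2 * 0)) = pt"
    by (rule alternating_bias_even[of 0]) (auto intro: strict_monoD[OF t_mono])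
  ultimately show "{p, pt} \<subseteq> range (alternating_bias t p pt)"
    by (metis empty_subsetI insert_subset rangeI)
qed

lemma eq_on_alternating_blocks:
  assumes odd: "\<And>j k. t (2 * k + 1) \<le> j \<Longrightarrow> j < t (2 * k + 2) \<Longrightarrow> w j = f p"
    and even: "\<And>j k. t (2 * k) \<le> j \<Longrightarrow> j < t (2 * k + 1) \<Longrightarrow> w j = f pt"
    and "t 0 \<le> j"
  shows "w j = f (alternating_bias t p pt j)"
proof -
  obtain n where block: "t n \<le> j" "j < t (Suc n)" using ex_block[OF \<open>t 0 \<le> j\<close>] .
  show ?thesis
  proof (cases "even n")
    case True
    then obtain k where "n = 2 * k" by blast
    then show ?thesis using block even[of k j] alternating_bias_even[of k j] by simp
  next
    case False
    then obtain k where "n = 2 * k + 1" by (elim oddE)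
    then show ?thesis using block odd[of k j] alternating_bias_odd[of k j] by simp
  qed
qed

lemma dominant_value_block:
  fixes m :: "nat \<Rightarrow> nat"
  assumes t_lim: "(\<lambda>n. real (t n) / real (t (Suc n))) \<longlonglongrightarrow> 0" and m_mono: "strict_mono m"
    and block: "\<And>k j. t (m k) \<le> j \<Longrightarrow> j < t (Suc (m k)) \<Longrightarrow> f j = u"
  shows "dominant_value f u"
proof (rule dominant_valueI)
  have less_t: "k < t (Suc (m k))" for k
    using strict_mono_imp_increasing[OF m_mono, of k] strict_mono_imp_increasing[OF t_mono, of "Suc (m k)"]
    by linarith
  show "f j = u" if "j \<in> {t (m k)..t (Suc (m k)) - 1}" for j k
    using that less_t[of k] by (intro block[of k]) auto
  have "k \<le> t (Suc (m k)) - 1" for k using less_t[of k] by simp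
  then show "filterlim (\<lambda>k. t (Suc (m k)) - 1) at_top sequentially"
    by (intro filterlim_at_top_mono[OF filterlim_ident]) simp
  show "(\<lambda>k. real (t (m k)) / real (t (Suc (m k)) - 1)) \<longlonglongrightarrow> 0"
  proof (rule tendsto_ratio_pred)
    show "(\<lambda>k. real (t (m k)) / real (t (Suc (m k)))) \<longlonglongrightarrow> 0"
      using LIMSEQ_subseq_LIMSEQ[OF t_lim m_mono] by (simp add: comp_def)
    show "\<forall>\<^sub>F k in sequentially. 2 \<le> t (Suc (m k))"
      using eventually_ge_at_top[of 1]
    proof eventually_elim
      case (elim k)
      then show ?case using less_t[of k] by linarith
    qed
  qed
qed

lemma dominant_value_alternating_bias:
  assumes t_lim: "(\<lambda>n. real (t n) / real (t (Suc n))) \<longlonglongrightarrow> 0" and u_cases: "u = p \<or> u = pt"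
  shows "dominant_value (alternating_bias t p pt) u"
  using u_cases
proof
  assume "u = p"
  then show ?thesis
    using alternating_bias_odd
    by (intro dominant_value_block[OF t_lim, of "\<lambda>k. 2 * k + 1"]) (auto simp: strict_mono_def)
next
  assume "u = pt"
  then show ?thesis
    using alternating_bias_even
    by (intro dominant_value_block[OF t_lim, of "\<lambda>k. 2 * k"]) (auto simp: strict_mono_def)
qed

end

theorem proposition9:
  fixes p pt :: real
    and t :: "nat \<Rightarrow> nat"
    and \<omega> :: "nat \<Rightarrow> bool \<Rightarrow> real"
    and \<mu> :: "cantor measure"
    and b B :: "real \<Rightarrow> ereal"
    and Bl Br :: "real \<Rightarrow> real"
  assumes p: "0 < p" "p < pt" "pt \<le> 1/2"
    and t: "t 0 = 1" "strict_mono t"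
    and t_lim: "(\<lambda>n. real (t n) / real (t (Suc n))) \<longlonglongrightarrow> 0"
    and \<omega>_odd: "\<And>j k e. k \<ge> 1 \<Longrightarrow> t (2 * k - 1) \<le> j \<Longrightarrow> j < t (2 * k) \<Longrightarrow>
                   \<omega> j e = (if e then 1 - p else p)"
    and \<omega>_even: "\<And>j k e. t (2 * k) \<le> j \<Longrightarrow> j < t (2 * k + 1) \<Longrightarrow>
                   \<omega> j e = (if e then 1 - pt else pt)"
    and \<mu>: "sets \<mu> = sets borel" "prob_space \<mu>"
    and \<mu>_cyl: "\<And>\<epsilon> n. measure \<mu> (cylinder \<epsilon> n) = (\<Prod>j=1..n. \<omega> j (\<epsilon> j))"
  defines "b \<equiv> mf_b \<mu> (msupport \<mu>)"
    and "B \<equiv> mf_B \<mu> (msupport \<mu>)"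
    and "Bl \<equiv> left_deriv (\<lambda>q. real_of_ereal (B q))"
    and "Br \<equiv> right_deriv (\<lambda>q. real_of_ereal (B q))"
  shows "(\<forall>\<alpha>\<in>{- log 2 (1 - pt) <..< - log 2 pt}.
            hausdorff_dim (level_set \<mu> \<alpha>) = (INF q. b q + ereal (\<alpha> * q)))
       \<and> (\<forall>\<alpha>\<in>{- log 2 (1 - pt) <..< - log 2 pt} - ({- Br 0 .. - Bl 0} \<union> {- Br 1 .. - Bl 1}).
            packing_dim (level_set \<mu> \<alpha>) = (INF q. B q + ereal (\<alpha> * q)))"
proof -
  note range = range_alternating_bias[OF t(2), of p pt]
  have bias: "0 < alternating_bias t p pt j" "alternating_bias t p pt j < 1" for j
    using p by (auto simp: alternating_bias_def)
  have \<omega>: "\<omega> j = (\<lambda>e. pmf (coin (alternating_bias t p pt j)) e)" if "1 \<le> j" for j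
    using that t p \<omega>_odd[of "Suc _"] \<omega>_even
    by (intro eq_on_alternating_blocks[where f = "\<lambda>u e. pmf (coin u) e"])
      (auto simp: pmf_coin fun_eq_iff)
  interpret prob_space \<mu> by (rule \<mu>)
  interpret two_bias_measure \<mu> "alternating_bias t p pt" p pt
  proof
    show "measure \<mu> (cylinder \<epsilon> n) = (\<Prod>j=1..n. pmf (coin (alternating_bias t p pt j)) (\<epsilon> j))" for \<epsilon> n
      unfolding \<mu>_cyl by (intro prod.cong) (simp_all add: \<omega>)
  qed (use range bias p dominant_value_alternating_bias[OF t(2) t_lim] in auto)
  show ?thesis
    unfolding b_def Bl_def Br_def B_def msupport_eq_UNIV one_sided_derivs_mf_B minus_minus
    using hausdorff_dim_level_set_eq packing_dim_level_set_eq by auto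
qed

end
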